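(* Let $n,\ell,q\ge 1$ be integers and $0\le\alpha,\gamma\le1$ with $\gamma\le 1-\alpha$. Let $\mathcal F_n$ be the family of all functions $f:\{0,1\}^n\to\{0,1\}^n$. Then every two-message, non-adaptive, $\ell$-query $(q,\alpha,\gamma)$-key-agreement protocol $\Pi$ relative to $\mathcal F_n$ has communication complexity $$\mathrm{CC}(\Pi)\;\ge\;\frac{(1-\alpha-\gamma)^2\,q}{50^2\,\ell}-6.$$
   Context: Oracle-aided protocols: A two-party oracle-aided protocol $\Pi=(\mathsf A,\mathsf B)$ is a pair of (computationally unbounded) probabilistic interactive parties with independent private coins and no shared randomness, who exchange messages and have query access to a common oracle $f$; each outputs one bit, $\mathrm{out}^{\mathsf A}$ and $\mathrm{out}^{\mathsf B}$, at the end. $\Pi^f$ denotes a random execution with oracle $f$, $\mathrm{trans}$ is its transcript (the list of exchanged messages), and $\mathrm{CC}(\Pi)$ is the worst-case length in bits of the transcript. $\Pi$ is $\ell$-query if each party makes at most $\ell$ oracle queries. $\Pi$ is non-adaptive if each party chooses all its queries before the protocol starts and before querying the oracle (so $\mathsf A$'s query list $X$, $\mathsf B$'s query list $Y$ and the oracle are mutually independent). $\Pi$ is two-message if $\mathsf A$ first sends a message $M_1$, a (possibly randomized) function of $X,f(X)$, and then $\mathsf B$ sends a message $M_2$, a (possibly randomized) function of $Y,f(Y),M_1$, after which the parties produce their outputs. Key agreement: $\Pi$ is a $(q,\alpha,\gamma)$-key-agreement protocol relative to a finite function family $\mathcal F$ if (Accuracy) for every $f\in\mathcal F$, $\Pr_{\Pi^f}[\mathrm{out}^{\mathsf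 A}=\mathrm{out}^{\mathsf B}]\ge 1-\alpha$; and (Secrecy) for every (computationally unbounded, possibly randomized) oracle algorithm $\mathsf E$ making at most $q$ queries, $\Pr_{f\leftarrow\mathcal F,\ \Pi^f}[\mathsf E^f(\mathrm{trans})=\mathrm{out}^{\mathsf A}]\le\gamma$, where $f\leftarrow\mathcal F$ is uniform. *)

theory Defs
  imports "HOL-Probability.Probability"
begin

type_synonym bits = "bool list"

type_synonym transcript = "bits list"

definition bitstrings :: "nat \<Rightarrow> bits set" where
  "bitstrings n = {x. length x = n}"

text \<open>The oracles are extensional functions, so that each map on n-bit strings is represented
  exactly once and the family is a finite set.\<close>

definition all_functions :: "nat \<Rightarrow> (bits \<Rightarrow> bits) set" where
  "all_functions n = bitstrings n \<rightarrow>\<^sub>E bitstrings n"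

text \<open>A two-message non-adaptive protocol. Each party draws all of its private coins at the
  start. The query lists depend on the coins only (non-adaptivity); the messages and the outputs
  may depend on the coins, on the list of answers to the party's own queries, and on what the party
  has received so far. No separate argument for a party's own query list is needed, since it is a
  function of the coins. Randomized message and output functions are covered by the coins.\<close>

record ('a, 'b) protocol =
  coins_A :: "'a pmf"
  queries_A :: "'a \<Rightarrow> bits list"
  message_A :: "'a \<Rightarrow> bits list \<Rightarrow> bits"
  output_A :: "'a \<Rightarrow> bits list \<Rightarrow> transcript \<Rightarrow> bool"
  coins_B :: "'b pmf"
  queries_B :: "'b \<Rightarrow> bits list"
  message_B :: "'b \<Rightarrow> bits list \<Rightarrow> bits \<Rightarrow> bits"
  output_B :: "'b \<Rightarrow> bits list \<Rightarrow> transcript \<Rightarrow> bool"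

definition query_protocol :: "nat \<Rightarrow> nat \<Rightarrow> ('a, 'b) protocol \<Rightarrow> bool" where
  "query_protocol n l P \<longleftrightarrow>
     (\<forall>r\<in>set_pmf (coins_A P).
        length (queries_A P r) \<le> l \<and> set (queries_A P r) \<subseteq> bitstrings n) \<and>
     (\<forall>s\<in>set_pmf (coins_B P).
        length (queries_B P s) \<le> l \<and> set (queries_B P s) \<subseteq> bitstrings n)"

text \<open>The joint distribution of both outputs and the transcript in a random execution with
  oracle \<open>f\<close>; \<open>pair_pmf\<close> makes the coins of the two parties independent.\<close>

definition execution ::
    "('a, 'b) protocol \<Rightarrow> (bits \<Rightarrow> bits) \<Rightarrow> (bool \<times> bool \<times> transcript) pmf" where
  "execution P f =
     map_pmf (\<lambda>(r, s).
       let u = map f (queries_A P r);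
           v = map f (queries_B P s);
           m1 = message_A P r u;
           m2 = message_B P s v m1;
           t = [m1, m2]
       in (output_A P r u t, output_B P s v t, t))
     (pair_pmf (coins_A P) (coins_B P))"

text \<open>The supremum is taken in \<open>enat\<close>: it is infinite if the transcript length is unbounded.\<close>

definition communication_complexity :: "(bits \<Rightarrow> bits) set \<Rightarrow> ('a, 'b) protocol \<Rightarrow> enat" where
  "communication_complexity F P =
     (SUP f\<in>F. SUP (a, b, t)\<in>set_pmf (execution P f). enat (sum_list (map length t)))"

text \<open>Deterministic (adaptive) oracle algorithms with one output bit, as decision trees.\<close>

datatype oracle_alg = Output bool | Query bits "bits \<Rightarrow> oracle_alg"

primrec run :: "(bits \<Rightarrow> bits) \<Rightarrow> oracle_alg \<Rightarrow> bool" where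
  "run f (Output b) = b"
| "run f (Query x k) = run f (k (f x))"

primrec queries_made :: "(bits \<Rightarrow> bits) \<Rightarrow> oracle_alg \<Rightarrow> bits list" where
  "queries_made f (Output b) = []"
| "queries_made f (Query x k) = x # queries_made f (k (f x))"

text \<open>A randomized adversary: given the transcript, it first draws its coins, which amounts to
  drawing a deterministic oracle algorithm, and then runs that algorithm.\<close>

type_synonym adversary = "transcript \<Rightarrow> oracle_alg pmf"

definition query_adversary :: "nat \<Rightarrow> (bits \<Rightarrow> bits) set \<Rightarrow> nat \<Rightarrow> adversary \<Rightarrow> bool" where
  "query_adversary n F q E \<longleftrightarrow>
     (\<forall>t. \<forall>T\<in>set_pmf (E t). \<forall>f\<in>F.
        length (queries_made f T) \<le> q \<and> set (queries_made f T) \<subseteq> bitstrings n)"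

definition accuracy :: "(bits \<Rightarrow> bits) set \<Rightarrow> real \<Rightarrow> ('a, 'b) protocol \<Rightarrow> bool" where
  "accuracy F \<alpha> P \<longleftrightarrow>
     (\<forall>f\<in>F. measure_pmf.prob (execution P f) {(a, b, t). a = b} \<ge> 1 - \<alpha>)"

definition guess_game ::
    "(bits \<Rightarrow> bits) set \<Rightarrow> ('a, 'b) protocol \<Rightarrow> adversary \<Rightarrow> bool pmf" where
  "guess_game F P E =
     bind_pmf (pmf_of_set F) (\<lambda>f.
     bind_pmf (execution P f) (\<lambda>(a, b, t).
     map_pmf (\<lambda>T. run f T = a) (E t)))"

definition secrecy ::
    "nat \<Rightarrow> (bits \<Rightarrow> bits) set \<Rightarrow> nat \<Rightarrow> real \<Rightarrow> ('a, 'b) protocol \<Rightarrow> bool" where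
  "secrecy n F q \<gamma> P \<longleftrightarrow>
     (\<forall>E. query_adversary n F q E \<longrightarrow> pmf (guess_game F P E) True \<le> \<gamma>)"

text \<open>The argument \<open>n\<close> is the input length of the oracles in \<open>F\<close>.\<close>

definition key_agreement ::
    "nat \<Rightarrow> (bits \<Rightarrow> bits) set \<Rightarrow> nat \<Rightarrow> real \<Rightarrow> real \<Rightarrow> ('a, 'b) protocol \<Rightarrow> bool" where
  "key_agreement n F q \<alpha> \<gamma> P \<longleftrightarrow> accuracy F \<alpha> P \<and> secrecy n F q \<gamma> P"

end

theory Submission
  imports Defs
begin

text \<open>Let \<open>\<delta> = 2 l / q\<close>. The eavesdropper queries every point that Bob queries with probability more
  than \<open>\<delta>\<close>, and then every point that Alice queries with probability more than \<open>\<delta>\<close> given her message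
  and these answers; there are at most \<open>l / \<delta>\<close> points of either kind. She outputs the value of Alice's
  output that is likelier given everything she has seen.

  Entropy relative to the uniform distribution is supermodular in the set of revealed answers.
  Hence revealing the answers on a random set that contains each point with probability at most
  \<open>\<delta>\<close> costs on average at most a \<open>\<delta>\<close>-fraction of the entropy of a message, which is \<open>O(c)\<close> for \<open>c\<close> bits of
  communication, and by Pinsker's inequality it changes the distribution of the message by
  \<open>O(sqrt (\<delta> c))\<close>. This is applied first to Alice's message and Bob's query set, and then, given
  Alice's message, to Bob's message together with his output and Alice's query set. So the two outputs
  are independent given the eavesdropper's view up to \<open>O(sqrt (\<delta> c))\<close>, and she guesses Alice's output
  almost as often as Bob does.\<close>

subsection \<open>Entropy and expectation inequalities\<close>

text \<open>The map \<open>(k, b) \<mapsto> k * ln (k / b)\<close> is convex and homogeneous, and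
  the left side is its tangent plane in the direction \<open>(A, B)\<close>. Concretely this is
  \<open>ln x \<le> x - 1\<close> at \<open>x = b * A / (k * B)\<close>, multiplied by
  \<open>k\<close>.\<close>

lemma log_tangent:
  fixes k b A B :: real
  assumes "k > 0" "b > 0" "A > 0" "B > 0"
  shows "k * ln A - k * ln B + k - b * (A / B) \<le> k * ln k - k * ln b"
proof -
  have "ln (b * A / (k * B)) \<le> b * A / (k * B) - 1"
    using assms by (intro ln_le_minus_one) simp
  then have "ln b + ln A - ln k - ln B \<le> b * A / (k * B) - 1"
    using assms by (simp add: ln_mult ln_div)
  then have "k * (ln b + ln A - ln k - ln B) \<le> k * (b * A / (k * B) - 1)"
    using assms by simp
  also have "\<dots> = b * (A / B) - k"
    using assms by (simp add: field_simps)
  finally show ?thesis by (simp add: algebra_simps)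
qed

text \<open>A linearised form of Pinsker's inequality, through the Hellinger distance:
  \<open>t ln t - t + 1 \<ge> (sqrt t - 1)\<^sup>2\<close> with \<open>t = a / b\<close>.\<close>

lemma pinsker_pointwise:
  fixes a b \<tau> :: real
  assumes "0 \<le> a" "0 \<le> b" "b = 0 \<Longrightarrow> a = 0" "\<tau> > 0"
  shows "\<bar>a - b\<bar> \<le> (a * ln a - a * ln b - a + b) / (2 * \<tau>) + \<tau> * (a + b)"
proof -
  define u v where "u = sqrt a" and "v = sqrt b"
  have uv: "u \<ge> 0" "v \<ge> 0" "a = u\<^sup>2" "b = v\<^sup>2"
    using assms by (auto simp: u_def v_def)
  have hell: "(u - v)\<^sup>2 \<le> a * ln a - a * ln b - a + b"
  proof (cases "a = 0")
    case True
    then show ?thesis using uv by simp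
  next
    case False
    then have pos: "u > 0" "v > 0" using assms uv by (auto simp: less_le)
    have "ln (v / u) \<le> v / u - 1" using pos by (intro ln_le_minus_one) simp
    then have "u\<^sup>2 * (ln v - ln u) \<le> u\<^sup>2 * (v / u - 1)"
      using pos by (intro mult_left_mono) (auto simp: ln_div)
    also have "\<dots> = u * v - u\<^sup>2"
      using pos by (simp add: field_simps power2_eq_square)
    finally have "u\<^sup>2 * (ln v - ln u) \<le> u * v - u\<^sup>2" .
    moreover have "ln a = 2 * ln u" "ln b = 2 * ln v"
      using pos uv by (simp_all add: ln_realpow)
    ultimately show ?thesis using uv by (simp add: algebra_simps power2_eq_square)
  qed
  have "\<bar>a - b\<bar> = \<bar>u - v\<bar> * (u + v)"
    using uv by (simp add: power2_eq_square square_diff_square_factored abs_mult)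
  \<comment> \<open>AM-GM with weight \<tau>. With \<tau> left free the bound is linear in the
    relative entropy, so it can be averaged before \<tau> is chosen.\<close>
  also have "\<dots> \<le> (u - v)\<^sup>2 / (2 * \<tau>) + \<tau> / 2 * (u + v)\<^sup>2"
  proof -
    have "0 \<le> (\<bar>u - v\<bar> - \<tau> * (u + v))\<^sup>2" by simp
    then have "2 * \<tau> * (\<bar>u - v\<bar> * (u + v)) \<le> (u - v)\<^sup>2 + \<tau> * \<tau> * (u + v)\<^sup>2"
      by (simp add: power2_diff power_mult_distrib) (simp add: power2_eq_square algebra_simps)
    then have "\<bar>u - v\<bar> * (u + v) \<le> ((u - v)\<^sup>2 + \<tau> * \<tau> * (u + v)\<^sup>2) / (2 * \<tau>)"
      using assms by (simp add: pos_le_divide_eq mult.commute)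
    then show ?thesis using assms by (simp add: add_divide_distrib)
  qed
  also have "\<dots> \<le> (a * ln a - a * ln b - a + b) / (2 * \<tau>) + \<tau> * (a + b)"
  proof -
    have "(u + v)\<^sup>2 \<le> 2 * (a + b)"
      using uv zero_le_power2[of "u - v"] by (simp add: power2_eq_square algebra_simps)
    then have "\<tau> / 2 * (u + v)\<^sup>2 \<le> \<tau> * (a + b)"
      using assms mult_left_mono[of "(u + v)\<^sup>2" "2 * (a + b)" "\<tau> / 2"] by simp
    then show ?thesis
      using hell assms by (intro add_mono divide_right_mono) auto
  qed
  finally show ?thesis .
qed

text \<open>Relative entropy to the uniform distribution on \<open>W\<close> is nonnegative: this is
  \<open>ln x \<le> x - 1\<close> at \<open>x = 1 / (c v * card W)\<close>, whose linear terms
  cancel on summation.\<close>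

lemma shannon_le_ln_card:
  fixes c :: "'w \<Rightarrow> real"
  assumes "finite W" "\<And>v. v \<in> W \<Longrightarrow> 0 \<le> c v" "(\<Sum>v\<in>W. c v) = 1"
  shows "- (\<Sum>v\<in>W. c v * ln (c v)) \<le> ln (card W)"
proof -
  define K where "K = real (card W)"
  have "W \<noteq> {}" using assms(3) by auto
  then have K: "K > 0" using assms(1) by (simp add: K_def card_gt_0_iff)
  have pt: "- (c v * ln (c v)) \<le> c v * ln K + 1 / K - c v" if v: "v \<in> W" for v
  proof (cases "c v = 0")
    case True
    then show ?thesis using K by simp
  next
    case False
    then have c: "c v > 0" using assms(2)[OF v] by simp
    have "ln (1 / (c v * K)) \<le> 1 / (c v * K) - 1"
      using c K by (intro ln_le_minus_one) simp
    then have "- ln (c v) - ln K \<le> 1 / (c v * K) - 1"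
      using c K by (simp add: ln_div ln_mult)
    then have "c v * (- ln (c v) - ln K) \<le> c v * (1 / (c v * K) - 1)"
      using c by (intro mult_left_mono) auto
    also have "\<dots> = 1 / K - c v" using c by (simp add: field_simps)
    finally show ?thesis by (simp add: algebra_simps)
  qed
  have "- (\<Sum>v\<in>W. c v * ln (c v)) \<le> (\<Sum>v\<in>W. c v * ln K + 1 / K - c v)"
    unfolding sum_negf[symmetric] by (intro sum_mono pt)
  also have "\<dots> = ln K"
    using assms(3) K by (simp add: sum.distrib sum_subtractf sum_distrib_right[symmetric] K_def)
  finally show ?thesis by (simp add: K_def)
qed

section \<open>Expectations of real functions of random coins\<close>

lemma integrable_pmf_bounded:
  fixes h :: "'r \<Rightarrow> real"
  assumes "\<And>r. \<bar>h r\<bar> \<le> C"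
  shows "integrable (measure_pmf p) h"
  by (rule measure_pmf.integrable_const_bound[where B = C]) (use assms in auto)

lemma abs_expectation_le:
  fixes h :: "'r \<Rightarrow> real"
  assumes "\<And>r. \<bar>h r\<bar> \<le> C"
  shows "\<bar>measure_pmf.expectation p h\<bar> \<le> C"
proof -
  have int: "integrable (measure_pmf p) h"
    using assms by (rule integrable_pmf_bounded)
  have "h r \<le> C" "- C \<le> h r" for r
    using assms[of r] by auto
  then have "measure_pmf.expectation p h \<le> C" "- C \<le> measure_pmf.expectation p h"
    using int by (auto intro!: measure_pmf.integral_le_const measure_pmf.integral_ge_const)
  then show ?thesis by simp
qed

lemma expectation_mono:
  fixes g h :: "'r \<Rightarrow> real"
  assumes "integrable (measure_pmf p) g" "integrable (measure_pmf p) h" "\<And>r. g r \<le> h r"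
  shows "measure_pmf.expectation p g \<le> measure_pmf.expectation p h"
  using assms by (intro integral_mono) auto

lemma integrable_pmf_dominated:
  fixes g h :: "'r \<Rightarrow> real"
  assumes "integrable (measure_pmf p) h" "\<And>r. \<bar>g r\<bar> \<le> h r"
  shows "integrable (measure_pmf p) g"
proof (rule Bochner_Integration.integrable_bound[OF assms(1)])
  show "AE r in measure_pmf p. norm (g r) \<le> norm (h r)"
    using assms(2) by (intro AE_I2) (force intro: order_trans[OF _ abs_ge_self])
qed simp

lemma abs_expectation_le_expectation:
  fixes g h :: "'r \<Rightarrow> real"
  assumes "integrable (measure_pmf p) h" "\<And>r. \<bar>g r\<bar> \<le> h r"
  shows "\<bar>measure_pmf.expectation p g\<bar> \<le> measure_pmf.expectation p h"
proof -
  have "\<bar>measure_pmf.expectation p g\<bar> \<le> measure_pmf.expectation p (\<lambda>r. \<bar>g r\<bar>)"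
    by (rule integral_abs_bound)
  also have "\<dots> \<le> measure_pmf.expectation p h"
    using assms by (intro expectation_mono integrable_abs integrable_pmf_dominated[OF assms]) auto
  finally show ?thesis .
qed

lemma expectation_of_bool_mem:
  "measure_pmf.expectation p (\<lambda>s. of_bool (x \<in> Y s)) = measure_pmf.prob p {s. x \<in> Y s}"
proof -
  have "(\<lambda>s. of_bool (x \<in> Y s) :: real) = indicator {s. x \<in> Y s}"
    by (auto simp: indicator_def)
  then show ?thesis by simp
qed

lemma abs_mult_le_one:
  fixes t u :: real
  assumes "\<bar>t\<bar> \<le> 1" "\<bar>u\<bar> \<le> 1"
  shows "\<bar>t * u\<bar> \<le> 1"
  using mult_mono[OF assms] by (simp add: abs_mult)

text \<open>Tonelli's theorem for the nonnegative integral, carried over to real expectations by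
  means of the bounds on \<open>h\<close>.\<close>

lemma expectation_pair_pmf:
  fixes h :: "'r \<times> 's \<Rightarrow> real"
  assumes "\<And>z. 0 \<le> h z" "\<And>z. h z \<le> C"
  shows "measure_pmf.expectation (pair_pmf p q) h =
    measure_pmf.expectation p (\<lambda>r. measure_pmf.expectation q (\<lambda>s. h (r, s)))"
proof -
  have b: "\<bar>h z\<bar> \<le> C" for z using assms[of z] by simp
  have nn: "0 \<le> measure_pmf.expectation q (\<lambda>s. h (r, s))" for r
    using assms by simp
  have "ennreal (measure_pmf.expectation (pair_pmf p q) h) = (\<integral>\<^sup>+z. ennreal (h z) \<partial>pair_pmf p q)"
    using assms b by (intro nn_integral_eq_integral[symmetric] integrable_pmf_bounded[where C = C]) auto
  also have "\<dots> = (\<integral>\<^sup>+r. \<integral>\<^sup>+s. ennreal (h (r, s)) \<partial>q \<partial>p)"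
    by (rule nn_integral_pair_pmf')
  also have "\<dots> = (\<integral>\<^sup>+r. ennreal (measure_pmf.expectation q (\<lambda>s. h (r, s))) \<partial>p)"
    using assms b
    by (intro nn_integral_cong nn_integral_eq_integral integrable_pmf_bounded[where C = C]) auto
  also have "\<dots> = ennreal (measure_pmf.expectation p (\<lambda>r. measure_pmf.expectation q (\<lambda>s. h (r, s))))"
    using nn b
    by (intro nn_integral_eq_integral integrable_pmf_bounded[where C = C] abs_expectation_le) auto
  finally show ?thesis
    using assms nn by simp
qed

subsection \<open>Uniformly random oracles\<close>

abbreviation patch :: "'x set \<Rightarrow> ('x \<Rightarrow> 'v) \<Rightarrow> ('x \<Rightarrow> 'v) \<Rightarrow> 'x \<Rightarrow> 'v" where
  "patch S f g \<equiv> override_on g f S"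

locale finite_oracles =
  fixes N :: "'x set" and V :: "'v set"
  assumes finite_N: "finite N" and finite_V: "finite V" and V_nonempty: "V \<noteq> {}"
begin

definition oracles :: "('x \<Rightarrow> 'v) set" where
  "oracles = N \<rightarrow>\<^sub>E V"

definition avg :: "(('x \<Rightarrow> 'v) \<Rightarrow> real) \<Rightarrow> real" where
  "avg h = (\<Sum>f\<in>oracles. h f) / card oracles"

text \<open>Conditional expectation given the answers on \<open>S\<close>. The values of a uniform
  oracle at different points are independent, so it is realised by resampling all answers outside
  \<open>S\<close> from a fresh oracle.\<close>

definition cond :: "'x set \<Rightarrow> (('x \<Rightarrow> 'v) \<Rightarrow> real) \<Rightarrow> ('x \<Rightarrow> 'v) \<Rightarrow> real" where
  "cond S h f = avg (\<lambda>g. h (patch S f g))"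

text \<open>Measurability with respect to the answers on \<open>S\<close>.\<close>

definition depends :: "'x set \<Rightarrow> (('x \<Rightarrow> 'v) \<Rightarrow> 'c) \<Rightarrow> bool" where
  "depends S h \<longleftrightarrow> (\<forall>f\<in>oracles. \<forall>g\<in>oracles. (\<forall>x\<in>S. f x = g x) \<longrightarrow> h f = h g)"

section \<open>Averages and conditional averages over all oracles\<close>

lemma finite_oracles: "finite oracles"
  unfolding oracles_def by (intro finite_PiE finite_N finite_V)

lemma oracles_nonempty: "oracles \<noteq> {}"
  unfolding oracles_def using V_nonempty by (simp add: PiE_eq_empty_iff)

lemma card_oracles_pos: "card oracles > 0"
  using finite_oracles oracles_nonempty by (simp add: card_gt_0_iff)

lemma patch_in_oracles [simp]: "f \<in> oracles \<Longrightarrow> g \<in> oracles \<Longrightarrow> patch S f g \<in> oracles"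
  unfolding oracles_def override_on_def by (auto simp: PiE_iff extensional_def)

lemma avg_cong: "(\<And>f. f \<in> oracles \<Longrightarrow> h f = k f) \<Longrightarrow> avg h = avg k"
  unfolding avg_def by simp

lemma avg_mono: "(\<And>f. f \<in> oracles \<Longrightarrow> h f \<le> k f) \<Longrightarrow> avg h \<le> avg k"
  unfolding avg_def by (intro divide_right_mono sum_mono) auto

lemma avg_const [simp]: "avg (\<lambda>_. c) = c"
  unfolding avg_def using card_oracles_pos by simp

lemma avg_add: "avg (\<lambda>f. h f + k f) = avg h + avg k"
  unfolding avg_def by (simp add: sum.distrib add_divide_distrib)

lemma avg_diff: "avg (\<lambda>f. h f - k f) = avg h - avg k"
  unfolding avg_def by (simp add: sum_subtractf diff_divide_distrib)

lemma avg_cmult: "avg (\<lambda>f. c * h f) = c * avg h"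
  unfolding avg_def by (simp add: sum_distrib_left)

lemma avg_sum: "avg (\<lambda>f. \<Sum>i\<in>I. h i f) = (\<Sum>i\<in>I. avg (h i))"
  unfolding avg_def by (subst sum.swap) (simp add: sum_divide_distrib)

lemma avg_nonneg: "(\<And>f. f \<in> oracles \<Longrightarrow> 0 \<le> h f) \<Longrightarrow> 0 \<le> avg h"
  using avg_mono[of "\<lambda>_. 0" h] by simp

lemma avg_le_const: "(\<And>f. f \<in> oracles \<Longrightarrow> h f \<le> c) \<Longrightarrow> avg h \<le> c"
  using avg_mono[of h "\<lambda>_. c"] by simp

lemma abs_avg_le: "\<bar>avg h\<bar> \<le> avg (\<lambda>f. \<bar>h f\<bar>)"
  unfolding avg_def by (simp add: divide_right_mono sum_abs abs_divide)

lemma avg_eq_0_imp: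
  assumes "\<And>f. f \<in> oracles \<Longrightarrow> 0 \<le> h f" "avg h \<le> 0" "f \<in> oracles"
  shows "h f = 0"
proof -
  have "(\<Sum>f\<in>oracles. h f) \<le> 0"
    using assms(2) card_oracles_pos unfolding avg_def by (simp add: divide_le_0_iff)
  then have "(\<Sum>f\<in>oracles. h f) = 0"
    using sum_nonneg[of oracles h] assms(1) by fastforce
  then show ?thesis
    using sum_nonneg_eq_0_iff[of oracles h] finite_oracles assms(1,3) by blast
qed

lemma patch_patch [simp]: "patch S (patch S f g) (patch S g f) = f"
  by (auto simp: override_on_def)

text \<open>The involution \<open>(f, g) \<mapsto> (patch S f g, patch S g f)\<close> preserves the uniform measure on
  pairs, so resampling outside of \<open>S\<close> does not change the mean.\<close>

lemma avg_cond [simp]: "avg (cond S h) = avg h"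
proof -
  let ?t = "\<lambda>(f, g). (patch S f g, patch S g f)"
  have "(\<Sum>p\<in>oracles \<times> oracles. h (patch S (fst p) (snd p))) = (\<Sum>p\<in>oracles \<times> oracles. h (fst p))"
    by (rule sum.reindex_bij_witness[where i = ?t and j = ?t]) auto
  then have "(\<Sum>f\<in>oracles. \<Sum>g\<in>oracles. h (patch S f g)) = card oracles * (\<Sum>f\<in>oracles. h f)"
    by (simp add: sum.cartesian_product' sum_distrib_left)
  then show ?thesis
    unfolding cond_def avg_def using card_oracles_pos
    by (simp add: sum_divide_distrib[symmetric])
qed

text \<open>Independence of the answers: in the doubly patched oracle only the answers on
  \<open>S \<inter> T\<close> still come from \<open>f\<close>, and the rest,
  \<open>patch T g g'\<close>, is averaged out by \<open>avg_cond\<close>. Supermodularity of the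
  entropy rests on this.\<close>

lemma cond_cond:
  assumes "f \<in> oracles"
  shows "cond S (cond T h) f = cond (S \<inter> T) h f"
proof -
  have "patch T (patch S f g) g' = patch (S \<inter> T) f (patch T g g')" for g g'
    by (auto simp: override_on_def)
  then have "cond S (cond T h) f = avg (cond T (\<lambda>g. h (patch (S \<inter> T) f g)))"
    unfolding cond_def by simp
  also have "\<dots> = cond (S \<inter> T) h f"
    by (simp only: avg_cond) (simp add: cond_def)
  finally show ?thesis .
qed

lemma cond_cong:
  "(\<And>g. g \<in> oracles \<Longrightarrow> h g = k g) \<Longrightarrow> f \<in> oracles \<Longrightarrow> cond S h f = cond S k f"
  unfolding cond_def by (intro avg_cong) simp

lemma cond_empty [simp]: "cond {} h f = avg h"
  by (simp add: cond_def override_on_def)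

section \<open>Functions of the answers on a set\<close>

lemma dependsD:
  "depends S h \<Longrightarrow> f \<in> oracles \<Longrightarrow> g \<in> oracles \<Longrightarrow> (\<And>x. x \<in> S \<Longrightarrow> f x = g x) \<Longrightarrow> h f = h g"
  unfolding depends_def by blast

lemma depends_mono: "depends S h \<Longrightarrow> S \<subseteq> T \<Longrightarrow> depends T h"
  unfolding depends_def by blast

lemma depends_cond: "depends S (cond S h)"
  unfolding depends_def cond_def
proof (intro ballI impI avg_cong)
  fix f g k :: "'x \<Rightarrow> 'v"
  assume "\<forall>x\<in>S. f x = g x"
  then have "patch S f k = patch S g k"
    by (auto simp: override_on_def)
  then show "h (patch S f k) = h (patch S g k)"
    by simp
qed

lemma depends_comp: "depends S h \<Longrightarrow> depends S (\<lambda>f. k (h f))"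
  unfolding depends_def by metis

lemma depends_comp2: "depends S h1 \<Longrightarrow> depends S h2 \<Longrightarrow> depends S (\<lambda>f. k (h1 f) (h2 f))"
  unfolding depends_def by metis

lemma depends_sum:
  "(\<And>i. i \<in> I \<Longrightarrow> depends S (h i)) \<Longrightarrow> depends S (\<lambda>f. \<Sum>i\<in>I. h i f)"
  unfolding depends_def by (intro ballI impI sum.cong refl) blast

lemma depends_patch:
  assumes "depends S h" "f \<in> oracles" "g \<in> oracles" "S \<subseteq> T"
  shows "h (patch T f g) = h f"
proof -
  have "\<forall>x\<in>S. patch T f g x = f x"
    using assms(4) by (auto simp: override_on_def)
  then show ?thesis
    using assms(1-3) patch_in_oracles[OF assms(2,3), of T] unfolding depends_def by blast
qed

text \<open>Taking out what is known: resampling outside \<open>S\<close> leaves \<open>h\<close>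
  constant.\<close>

lemma cond_pull:
  "depends S h \<Longrightarrow> f \<in> oracles \<Longrightarrow> cond S (\<lambda>g. h g * k g) f = h f * cond S k f"
  unfolding cond_def by (subst avg_cmult[symmetric], intro avg_cong) (simp add: depends_patch)

lemma cond_depends: "depends S h \<Longrightarrow> f \<in> oracles \<Longrightarrow> cond S h f = h f"
  using cond_pull[of S h f "\<lambda>_. 1"] by (simp add: cond_def)

text \<open>A weight known from the answers on \<open>S\<close> cannot tell \<open>k\<close> from
  its conditional mean. Every replacement of an indicator by a conditional probability below is an
  instance.\<close>

lemma avg_pull:
  assumes "depends S h"
  shows "avg (\<lambda>f. h f * cond S k f) = avg (\<lambda>f. h f * k f)"
proof -
  have "avg (\<lambda>f. h f * cond S k f) = avg (cond S (\<lambda>f. h f * k f))"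
    using cond_pull[OF assms] by (intro avg_cong) simp
  then show ?thesis by simp
qed

text \<open>Since \<open>h\<close> is its own conditional mean given \<open>T\<close>, this is
  \<open>cond_cond\<close>.\<close>

lemma cond_restrict:
  assumes "depends T h" "f \<in> oracles"
  shows "cond S h f = cond (S \<inter> T) h f"
  using cond_cong[of h "cond T h" f S] cond_depends[OF assms(1)] cond_cond[OF assms(2)] assms(2)
  by simp

lemma depends_cond_inter:
  assumes "depends T h"
  shows "depends T (cond S h)"
proof -
  have "depends T (cond (S \<inter> T) h)"
    by (rule depends_mono[OF depends_cond]) simp
  then show ?thesis
    unfolding depends_def by (metis (no_types) cond_restrict[OF assms, of _ S])
qed

lemma cond_nonneg: "(\<And>g. g \<in> oracles \<Longrightarrow> 0 \<le> h g) \<Longrightarrow> f \<in> oracles \<Longrightarrow> 0 \<le> cond S h f"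
  unfolding cond_def by (intro avg_nonneg) simp

lemma cond_sum: "cond S (\<lambda>g. \<Sum>i\<in>I. h i g) f = (\<Sum>i\<in>I. cond S (h i) f)"
  unfolding cond_def by (rule avg_sum)

text \<open>The oracle \<open>f\<close> is itself one of those averaged over, because
  \<open>patch S f f = f\<close>. This gives the absolute continuity that the logarithms
  need.\<close>

lemma cond_eq_0_imp:
  assumes "\<And>g. g \<in> oracles \<Longrightarrow> 0 \<le> h g" "cond S h f = 0" "f \<in> oracles"
  shows "h f = 0"
proof -
  have "patch S f f = f"
    by (auto simp: override_on_def)
  moreover have "h (patch S f f) = 0"
    by (rule avg_eq_0_imp) (use assms in \<open>auto simp: cond_def\<close>)
  ultimately show ?thesis by simp
qed

section \<open>Entropy and its supermodularity\<close>

text \<open>A negative entropy, which grows as more answers are revealed. For indicators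
  \<open>p v\<close> of the values of a message, the sum of \<open>ent (cond S (p v))\<close> over
  \<open>v\<close> is minus the conditional entropy of the message given the answers on
  \<open>S\<close>, in nats.\<close>

definition ent :: "(('x \<Rightarrow> 'v) \<Rightarrow> real) \<Rightarrow> real" where
  "ent h = avg (\<lambda>f. h f * ln (h f))"

lemma ent_cong: "(\<And>f. f \<in> oracles \<Longrightarrow> h f = k f) \<Longrightarrow> ent h = ent k"
  unfolding ent_def by (intro avg_cong) simp

text \<open>The logarithm depends on \<open>S\<close> only, so \<open>k\<close> may be replaced by
  its conditional mean; this evaluates cross entropies.\<close>

lemma ent_cond: "avg (\<lambda>f. k f * ln (cond S k f)) = ent (cond S k)"
proof -
  have "avg (\<lambda>f. ln (cond S k f) * cond S k f) = avg (\<lambda>f. ln (cond S k f) * k f)"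
    by (rule avg_pull) (rule depends_comp[OF depends_cond])
  then show ?thesis by (simp add: ent_def mult.commute)
qed

text \<open>Supermodularity is the joint convexity of relative entropy, applied to the pair
  \<open>(k, cond T k)\<close> under averaging by \<open>cond S\<close>.\<close>

lemma ent_supermodular:
  assumes nn: "\<And>f. f \<in> oracles \<Longrightarrow> 0 \<le> k f"
  shows "ent (cond S k) + ent (cond T k) \<le> ent k + ent (cond (S \<inter> T) k)"
proof -
  define a b c where "a = cond S k" and "b = cond T k" and "c = cond (S \<inter> T) k"
  have pt: "k f * ln (a f) - k f * ln (c f) + k f - (a f / c f) * b f \<le> k f * ln (k f) - k f * ln (b f)"
    if f: "f \<in> oracles" for f
  proof (cases "k f = 0")
    case True
    have "0 \<le> a f" "0 \<le> b f" "0 \<le> c f"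
      using nn f by (auto simp: a_def b_def c_def intro!: cond_nonneg)
    with True show ?thesis by simp
  next
    case False
    have "cond U k f > 0" for U
    proof -
      have "cond U k f \<noteq> 0" using cond_eq_0_imp[of k U f] nn f False by blast
      moreover have "0 \<le> cond U k f" by (rule cond_nonneg) (use nn f in auto)
      ultimately show ?thesis by simp
    qed
    then have "a f > 0" "b f > 0" "c f > 0"
      by (simp_all add: a_def b_def c_def)
    moreover have "k f > 0" using nn[OF f] False by simp
    ultimately show ?thesis
      using log_tangent[of "k f" "b f" "a f" "c f"] by (simp add: mult.commute)
  qed
  have dep: "depends S (\<lambda>f. a f / c f)"
    using depends_comp2[of S a c "(/)"] depends_cond[of S k]
      depends_mono[OF depends_cond[of "S \<inter> T" k], of S]
    by (simp add: a_def c_def)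
  \<comment> \<open>The ratio depends on \<open>S\<close>, and \<open>cond S b = c\<close> by
    \<open>cond_cond\<close>, so the correction term of the tangent integrates to at most the mean
    of \<open>k\<close>.\<close>
  have "avg (\<lambda>f. (a f / c f) * b f) = avg (\<lambda>f. (a f / c f) * cond S b f)"
    using avg_pull[OF dep] by simp
  also have "\<dots> = avg (\<lambda>f. (a f / c f) * c f)"
    by (intro avg_cong) (simp add: b_def c_def cond_cond)
  \<comment> \<open>The two sides agree pointwise where \<open>c f\<close> is nonzero; where it
    vanishes, division by zero makes the left side 0.\<close>
  also have "\<dots> \<le> avg a"
    by (intro avg_mono) (use nn in \<open>auto simp: a_def intro!: cond_nonneg\<close>)
  finally have "avg (\<lambda>f. (a f / c f) * b f) \<le> avg k"
    by (simp add: a_def)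
  moreover have "avg (\<lambda>f. k f * ln (a f)) - avg (\<lambda>f. k f * ln (c f)) + avg k - avg (\<lambda>f. (a f / c f) * b f)
      \<le> ent k - avg (\<lambda>f. k f * ln (b f))"
    using avg_mono[OF pt] by (simp add: avg_add avg_diff ent_def)
  ultimately show ?thesis
    by (simp add: a_def b_def c_def ent_cond)
qed

text \<open>Supermodularity for \<open>cond (S \<union> T) k\<close>, whose conditional means given
  subsets of \<open>S \<union> T\<close> are those of \<open>k\<close>.\<close>

lemma ent_cond_supermodular:
  assumes nn: "\<And>f. f \<in> oracles \<Longrightarrow> 0 \<le> k f"
  shows "ent (cond S k) + ent (cond T k) \<le> ent (cond (S \<union> T) k) + ent (cond (S \<inter> T) k)"
proof -
  have "cond U (cond (S \<union> T) k) f = cond U k f" if "f \<in> oracles" "U \<subseteq> S \<union> T" for U f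
    using that by (simp add: cond_cond Int_absorb2)
  then have eq: "ent (cond U (cond (S \<union> T) k)) = ent (cond U k)" if "U \<subseteq> S \<union> T" for U
    using that by (intro ent_cong) simp
  have "ent (cond S (cond (S \<union> T) k)) + ent (cond T (cond (S \<union> T) k))
      \<le> ent (cond (S \<union> T) k) + ent (cond (S \<inter> T) (cond (S \<union> T) k))"
    using nn by (intro ent_supermodular cond_nonneg)
  then show ?thesis
    using eq[of S] eq[of T] eq[of "S \<inter> T"] by (simp add: le_infI1)
qed

text \<open>Supermodularity with an empty set: the two terms for the overall mean cancel.\<close>

lemma ent_cond_mono:
  assumes nn: "\<And>f. f \<in> oracles \<Longrightarrow> 0 \<le> k f" and "S \<subseteq> T"
  shows "ent (cond S k) \<le> ent (cond T k)"
proof -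
  have "ent (cond {} (cond T k)) + ent (cond S (cond T k)) \<le> ent (cond T k) + ent (cond ({} \<inter> S) (cond T k))"
    using nn by (intro ent_supermodular cond_nonneg)
  moreover have "ent (cond S (cond T k)) = ent (cond S k)"
    using assms(2) by (intro ent_cong) (simp add: cond_cond Int_absorb2)
  ultimately show ?thesis by simp
qed

text \<open>A chain rule: the points of \<open>U\<close> are revealed one after another on top of
  \<open>Q\<close>, and \<open>D x\<close> is the increase of \<open>ent\<close> at the moment when
  \<open>x\<close> is revealed. By supermodularity a point contributes no more when fewer points
  precede it, so the increments at the points of \<open>X\<close> bound the effect of revealing
  \<open>X \<inter> U\<close> alone. The same \<open>D\<close> serves for all
  \<open>X\<close>.\<close>

lemma ent_increments:
  assumes nn: "\<And>f. f \<in> oracles \<Longrightarrow> 0 \<le> k f" and "finite U"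
  shows "U \<inter> Q = {} \<Longrightarrow> \<exists>D. (\<forall>x. 0 \<le> D x) \<and> (\<Sum>x\<in>U. D x) = ent (cond (Q \<union> U) k) - ent (cond Q k) \<and>
     (\<forall>X. ent (cond (Q \<union> (X \<inter> U)) k) - ent (cond Q k) \<le> (\<Sum>x\<in>X \<inter> U. D x))"
  using assms(2)
proof (induction U rule: finite_induct)
  case empty
  show ?case by (intro exI[of _ "\<lambda>_. 0"]) simp
next
  case (insert y U)
  then obtain D where D: "\<And>x. 0 \<le> D x" "(\<Sum>x\<in>U. D x) = ent (cond (Q \<union> U) k) - ent (cond Q k)"
      "\<And>X. ent (cond (Q \<union> (X \<inter> U)) k) - ent (cond Q k) \<le> (\<Sum>x\<in>X \<inter> U. D x)"
    by auto
  define d where "d = ent (cond (Q \<union> insert y U) k) - ent (cond (Q \<union> U) k)"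
  have "d \<ge> 0"
    unfolding d_def using ent_cond_mono[of k "Q \<union> U" "Q \<union> insert y U"] nn by auto
  have same: "(\<Sum>x\<in>A. (D(y := d)) x) = (\<Sum>x\<in>A. D x)" if "y \<notin> A" for A
    using that by (intro sum.cong) auto
  have "(\<Sum>x\<in>insert y U. (D(y := d)) x) = d + (\<Sum>x\<in>U. D x)"
    using insert.hyps same[of U] by simp
  moreover have "ent (cond (Q \<union> (X \<inter> insert y U)) k) - ent (cond Q k) \<le> (\<Sum>x\<in>X \<inter> insert y U. (D(y := d)) x)"
    for X
  proof (cases "y \<in> X")
    case True
    have eqs: "(Q \<union> (X \<inter> insert y U)) \<union> (Q \<union> U) = Q \<union> insert y U"
         "(Q \<union> (X \<inter> insert y U)) \<inter> (Q \<union> U) = Q \<union> (X \<inter> U)"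
      using True insert.hyps insert.prems by auto
    have "ent (cond (Q \<union> (X \<inter> insert y U)) k) + ent (cond (Q \<union> U) k)
        \<le> ent (cond (Q \<union> insert y U) k) + ent (cond (Q \<union> (X \<inter> U)) k)"
      using ent_cond_supermodular[of k "Q \<union> (X \<inter> insert y U)" "Q \<union> U"] nn unfolding eqs by simp
    then have "ent (cond (Q \<union> (X \<inter> insert y U)) k) - ent (cond Q k) \<le> d + (\<Sum>x\<in>X \<inter> U. D x)"
      using D(3)[of X] by (simp add: d_def)
    then show ?thesis
      using True insert.hyps same[of "X \<inter> U"] by simp
  next
    case False
    then have "X \<inter> insert y U = X \<inter> U" by auto
    then show ?thesis using D(3)[of X] same[of "X \<inter> U"] insert.hyps by simp
  qed
  moreover have "d + (\<Sum>x\<in>U. D x) = ent (cond (Q \<union> insert y U) k) - ent (cond Q k)"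
    by (simp add: D(2) d_def)
  moreover have "\<forall>x. 0 \<le> (D(y := d)) x"
    using D(1) \<open>d \<ge> 0\<close> by simp
  ultimately show ?case
    by (intro exI[of _ "D(y := d)"] conjI allI) (simp_all only:)
qed

text \<open>Oracles are extensional, so two of them that agree on \<open>N\<close> are
  equal.\<close>

lemma depends_all: "depends N h"
proof -
  have "f = g" if "f \<in> oracles" "g \<in> oracles" "\<forall>x\<in>N. f x = g x" for f g
    using that unfolding oracles_def by (auto intro: PiE_ext)
  then show ?thesis unfolding depends_def by metis
qed

lemma cond_Int_N: "f \<in> oracles \<Longrightarrow> cond S h f = cond (S \<inter> N) h f"
  by (rule cond_restrict[OF depends_all])

section \<open>Decoupling messages from random query sets\<close>

lemma sum_cond_indicator:
  assumes "finite W" "\<And>f. f \<in> oracles \<Longrightarrow> w f \<in> W" "f \<in> oracles"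
  shows "(\<Sum>v\<in>W. cond S (\<lambda>f. of_bool (w f = v)) f) = 1"
proof -
  have "(\<Sum>v\<in>W. cond S (\<lambda>f. of_bool (w f = v)) f) = cond S (\<lambda>f. \<Sum>v\<in>W. of_bool (w f = v)) f"
    by (simp add: cond_sum)
  also have "\<dots> = cond S (\<lambda>_. 1) f"
    using assms by (intro cond_cong) (simp_all add: of_bool_def)
  finally show ?thesis by (simp add: cond_def)
qed

text \<open>Revealing the answers on \<open>X\<close> changes the distribution of \<open>w\<close> only through the increments
  \<open>D x\<close> with \<open>x \<in> X\<close>, which do not depend on \<open>X\<close> and sum up to at most the entropy of \<open>w\<close>. A random
  \<open>X\<close> that contains each point with small probability therefore reveals little.\<close>

lemma decoupling:
  fixes w :: "('x \<Rightarrow> 'v) \<Rightarrow> 'w"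
  assumes W: "finite W" "w ` oracles \<subseteq> W"
  defines "p \<equiv> \<lambda>v f. of_bool (w f = v) :: real"
  shows "\<exists>D. (\<forall>x. 0 \<le> D x) \<and> (\<Sum>x\<in>N - Q. D x) \<le> ln (card W) \<and>
    (\<forall>X \<tau>. \<tau> > 0 \<longrightarrow> avg (\<lambda>f. \<Sum>v\<in>W. \<bar>cond (X \<union> Q) (p v) f - cond Q (p v) f\<bar>)
        \<le> (\<Sum>x\<in>X \<inter> (N - Q). D x) / (2 * \<tau>) + 2 * \<tau>)"
proof -
  have p_nn: "0 \<le> p v f" for v f by (simp add: p_def)
  have "\<forall>v. \<exists>D. (\<forall>x. 0 \<le> D x) \<and> (\<Sum>x\<in>N - Q. D x) = ent (cond (Q \<union> (N - Q)) (p v)) - ent (cond Q (p v)) \<and>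
     (\<forall>X. ent (cond (Q \<union> (X \<inter> (N - Q))) (p v)) - ent (cond Q (p v)) \<le> (\<Sum>x\<in>X \<inter> (N - Q). D x))"
    using p_nn finite_N by (intro allI ent_increments) auto
  then obtain d where d: "\<And>v x. 0 \<le> d v x"
    "\<And>v. (\<Sum>x\<in>N - Q. d v x) = ent (cond (Q \<union> (N - Q)) (p v)) - ent (cond Q (p v))"
    "\<And>v X. ent (cond (Q \<union> (X \<inter> (N - Q))) (p v)) - ent (cond Q (p v)) \<le> (\<Sum>x\<in>X \<inter> (N - Q). d v x)"
    by metis
  define D where "D x = (\<Sum>v\<in>W. d v x)" for x
  have one: "(\<Sum>v\<in>W. cond S (p v) f) = 1" if "f \<in> oracles" for S f
    unfolding p_def by (rule sum_cond_indicator) (use W that in auto)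
  \<comment> \<open>All answers together determine \<open>w\<close>, so the conditional
    probabilities are 0 or 1 and the total increase of \<open>ent\<close> is the entropy that
    remains given \<open>Q\<close>.\<close>
  have full: "ent (cond (Q \<union> (N - Q)) (p v)) = 0" for v
  proof -
    have "cond (Q \<union> (N - Q)) (p v) f * ln (cond (Q \<union> (N - Q)) (p v) f) = 0" if "f \<in> oracles" for f
      using cond_depends[OF depends_mono[OF depends_all], of "Q \<union> (N - Q)" f "p v"] that
      by (auto simp: p_def)
    then show ?thesis unfolding ent_def using avg_cong[of _ "\<lambda>_. 0"] by simp
  qed
  have "(\<Sum>x\<in>N - Q. D x) = (\<Sum>v\<in>W. \<Sum>x\<in>N - Q. d v x)"
    unfolding D_def by (rule sum.swap)
  also have "\<dots> = - (\<Sum>v\<in>W. ent (cond Q (p v)))"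
    unfolding d(2) full by (simp add: sum_negf)
  also have "\<dots> = avg (\<lambda>f. - (\<Sum>v\<in>W. cond Q (p v) f * ln (cond Q (p v) f)))"
    using avg_cmult[of "-1"] by (simp add: ent_def avg_sum)
  also have "\<dots> \<le> ln (card W)"
    by (intro avg_le_const shannon_le_ln_card W(1) one cond_nonneg p_nn)
  finally have sumD: "(\<Sum>x\<in>N - Q. D x) \<le> ln (card W)" .
  have "avg (\<lambda>f. \<Sum>v\<in>W. \<bar>cond (X \<union> Q) (p v) f - cond Q (p v) f\<bar>)
      \<le> (\<Sum>x\<in>X \<inter> (N - Q). D x) / (2 * \<tau>) + 2 * \<tau>" if \<tau>: "\<tau> > 0" for X \<tau>
  proof -
    have one_value: "avg (\<lambda>f. \<bar>cond (X \<union> Q) (p v) f - cond Q (p v) f\<bar>)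
        \<le> (\<Sum>x\<in>X \<inter> (N - Q). d v x) / (2 * \<tau>) + 2 * \<tau> * avg (p v)" for v
    proof -
      define a b where "a = cond (X \<union> Q) (p v)" and "b = cond Q (p v)"
      have nn: "0 \<le> a f" "0 \<le> b f" if "f \<in> oracles" for f
        unfolding a_def b_def by (auto intro!: cond_nonneg p_nn that)
      have cb: "cond Q a f = b f" if "f \<in> oracles" for f
        using that by (simp add: a_def b_def cond_cond Int_absorb2)
      have "a f = 0" if "f \<in> oracles" "b f = 0" for f
        by (rule cond_eq_0_imp[of a Q]) (use nn cb that in auto)
      then have "avg (\<lambda>f. \<bar>a f - b f\<bar>)
          \<le> avg (\<lambda>f. 1 / (2 * \<tau>) * (a f * ln (a f) - a f * ln (b f) - a f + b f) + \<tau> * (a f + b f))"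
        using pinsker_pointwise[OF _ _ _ \<tau>] nn by (intro avg_mono) auto
      also have "\<dots> = 1 / (2 * \<tau>) * (ent a - avg (\<lambda>f. a f * ln (b f)) - avg a + avg b) + \<tau> * (avg a + avg b)"
        unfolding avg_add avg_cmult avg_diff ent_def by simp
      \<comment> \<open>As \<open>cond Q a = b\<close>, the cross term equals \<open>ent b\<close>,
        and the linear terms cancel because \<open>a\<close> and \<open>b\<close> have the same
        mean. What remains of the relative entropy is \<open>ent a - ent b\<close>.\<close>
      also have "avg (\<lambda>f. a f * ln (b f)) = avg (\<lambda>f. a f * ln (cond Q a f))"
        by (intro avg_cong) (simp add: cb)
      also have "\<dots> = ent b"
        unfolding ent_cond by (intro ent_cong cb)
      also have "avg a = avg (p v)" by (simp add: a_def)
      also have "avg b = avg (p v)" by (simp add: b_def)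
      also have "ent a = ent (cond (Q \<union> (X \<inter> (N - Q))) (p v))"
      proof (rule ent_cong)
        fix f assume f: "f \<in> oracles"
        have "(X \<union> Q) \<inter> N = (Q \<union> (X \<inter> (N - Q))) \<inter> N" by auto
        then show "a f = cond (Q \<union> (X \<inter> (N - Q))) (p v) f"
          unfolding a_def using f by (metis cond_Int_N)
      qed
      finally have "avg (\<lambda>f. \<bar>a f - b f\<bar>)
          \<le> (ent (cond (Q \<union> (X \<inter> (N - Q))) (p v)) - ent b) / (2 * \<tau>) + 2 * \<tau> * avg (p v)"
        by (simp add: algebra_simps diff_divide_distrib)
      moreover have "(ent (cond (Q \<union> (X \<inter> (N - Q))) (p v)) - ent b) / (2 * \<tau>) \<le> (\<Sum>x\<in>X \<inter> (N - Q). d v x) / (2 * \<tau>)"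
        unfolding b_def using d(3) \<tau> by (intro divide_right_mono) auto
      ultimately show ?thesis by (simp add: a_def b_def)
    qed
    have "(\<Sum>v\<in>W. avg (p v)) = 1"
    proof -
      obtain f where "f \<in> oracles" using oracles_nonempty by auto
      then show ?thesis using one[of f "{}"] by simp
    qed
    then have "(\<Sum>v\<in>W. (\<Sum>x\<in>X \<inter> (N - Q). d v x) / (2 * \<tau>) + 2 * \<tau> * avg (p v))
        = (\<Sum>x\<in>X \<inter> (N - Q). D x) / (2 * \<tau>) + 2 * \<tau>"
      unfolding D_def by (subst sum.swap)
        (simp add: sum.distrib sum_divide_distrib[symmetric] sum_distrib_left[symmetric])
    then show ?thesis
      unfolding avg_sum by (metis (lifting) one_value sum_mono)
  qed
  then show ?thesis
    using sumD d(1) by (intro exI[of _ D]) (auto simp: D_def sum_nonneg)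
qed

text \<open>Here \<open>\<alpha>\<close> and \<open>p\<close> are the indicators of the two messages and \<open>X\<close>, \<open>Y\<close> the query sets. The
  weight \<open>\<alpha> m\<close> is first decoupled from what the other party sees, so that it may be replaced by its
  mean.\<close>

lemma swap_error:
  fixes A :: "('x \<Rightarrow> 'v) \<Rightarrow> 'm" and B :: "'m \<Rightarrow> ('x \<Rightarrow> 'v) \<Rightarrow> 'w"
  assumes M: "finite M" and W: "finite W" "\<And>m f. f \<in> oracles \<Longrightarrow> B m f \<in> W"
    and A: "depends X A" and B: "\<And>m. depends Y (B m)"
    and a: "\<And>m v f. f \<in> oracles \<Longrightarrow> 0 \<le> a m v f" "\<And>m v f. f \<in> oracles \<Longrightarrow> a m v f \<le> 1"
      "\<And>m v. depends (X \<union> Q m) (a m v)"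
  defines "\<alpha> \<equiv> \<lambda>m f. of_bool (A f = m) :: real"
    and "p \<equiv> \<lambda>m v f. of_bool (B m f = v) :: real"
  shows "\<bar>(\<Sum>m\<in>M. \<Sum>v\<in>W. avg (\<lambda>f. \<alpha> m f * a m v f * p m v f)) -
      (\<Sum>m\<in>M. \<Sum>v\<in>W. avg (\<lambda>f. \<alpha> m f * a m v f * cond (Q m) (p m v) f))\<bar>
    \<le> 2 * avg (\<lambda>f. \<Sum>m\<in>M. \<bar>cond Y (\<alpha> m) f - avg (\<alpha> m)\<bar>) +
      (\<Sum>m\<in>M. avg (\<alpha> m) * avg (\<lambda>f. \<Sum>v\<in>W. \<bar>cond (X \<union> Q m) (p m v) f - cond (Q m) (p m v) f\<bar>))"
    (is "\<bar>?R - ?I\<bar> \<le> _")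
proof -
  define D where "D m f = (\<Sum>v\<in>W. \<bar>cond (X \<union> Q m) (p m v) f - cond (Q m) (p m v) f\<bar>)" for m f
  have \<alpha>: "0 \<le> \<alpha> m f" for m f by (simp add: \<alpha>_def)
  have dep\<alpha>: "depends (X \<union> Q m) (\<lambda>f. \<alpha> m f * a m v f)" for m v
    unfolding \<alpha>_def
    by (rule depends_comp2[of _ _ _ "\<lambda>c t. of_bool (c = m) * t"]) (use A a(3) in \<open>auto intro: depends_mono\<close>)
  have depp: "depends Y (p m v)" for m v
    unfolding p_def by (rule depends_comp[OF B])
  \<comment> \<open>Conditioning on further points brings in no answers outside \<open>Y\<close>,
    since \<open>p m v\<close> is a function of the answers on \<open>Y\<close>. Hence
    \<open>D m\<close> only sees the conditional mean of the weight given \<open>Y\<close>.\<close>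
  have depD: "depends Y (D m)" for m
    unfolding D_def
    by (intro depends_sum depends_comp2[of _ _ _ "\<lambda>s t. \<bar>s - t\<bar>"] depends_cond_inter depp)
  have D_nn: "0 \<le> D m f" for m f unfolding D_def by (intro sum_nonneg) simp
  have D_le: "D m f \<le> 2" if f: "f \<in> oracles" for m f
  proof -
    have nn: "0 \<le> cond S (p m v) f" for S v
      by (rule cond_nonneg) (use f in \<open>auto simp: p_def\<close>)
    have "D m f \<le> (\<Sum>v\<in>W. cond (X \<union> Q m) (p m v) f + cond (Q m) (p m v) f)"
      unfolding D_def
    proof (rule sum_mono)
      fix v show "\<bar>cond (X \<union> Q m) (p m v) f - cond (Q m) (p m v) f\<bar> \<le> cond (X \<union> Q m) (p m v) f + cond (Q m) (p m v) f"
        using nn[of "X \<union> Q m" v] nn[of "Q m" v] by linarith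
    qed
    also have "\<dots> = 2"
      unfolding sum.distrib p_def using W f by (simp add: sum_cond_indicator)
    finally show ?thesis .
  qed
  \<comment> \<open>The weight is known from \<open>X \<union> Q m\<close>, so in the real term
    \<open>p m v\<close> may be replaced by its conditional mean given that set.\<close>
  have "?R - ?I = (\<Sum>m\<in>M. \<Sum>v\<in>W. avg (\<lambda>f. \<alpha> m f * a m v f * (cond (X \<union> Q m) (p m v) f - cond (Q m) (p m v) f)))"
    unfolding right_diff_distrib avg_diff sum_subtractf avg_pull[OF dep\<alpha>] ..
  also have "\<bar>\<dots>\<bar> \<le> (\<Sum>m\<in>M. \<Sum>v\<in>W. avg (\<lambda>f. \<alpha> m f * \<bar>cond (X \<union> Q m) (p m v) f - cond (Q m) (p m v) f\<bar>))"
  proof (intro order_trans[OF sum_abs] sum_mono order_trans[OF abs_avg_le] avg_mono)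
    fix m v f assume f: "f \<in> oracles"
    have "\<alpha> m f * a m v f * t \<le> \<alpha> m f * t" if "0 \<le> t" for t
      using a(1,2)[OF f, of m v] \<alpha>[of m f] that by (intro mult_right_mono mult_left_le) auto
    then show "\<bar>\<alpha> m f * a m v f * (cond (X \<union> Q m) (p m v) f - cond (Q m) (p m v) f)\<bar>
       \<le> \<alpha> m f * \<bar>cond (X \<union> Q m) (p m v) f - cond (Q m) (p m v) f\<bar>"
      using a(1)[OF f, of m v] \<alpha>[of m f] by (simp add: abs_mult)
  qed
  also have "\<dots> = (\<Sum>m\<in>M. avg (\<lambda>f. D m f * \<alpha> m f))"
    by (simp add: avg_sum[symmetric] D_def sum_distrib_left mult.commute)
  also have "\<dots> \<le> (\<Sum>m\<in>M. 2 * avg (\<lambda>f. \<bar>cond Y (\<alpha> m) f - avg (\<alpha> m)\<bar>) + avg (\<alpha> m) * avg (D m))"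
  proof (rule sum_mono)
    fix m
    have "avg (\<lambda>f. D m f * \<alpha> m f) = avg (\<lambda>f. D m f * cond Y (\<alpha> m) f)"
      by (rule avg_pull[OF depD, symmetric])
    also have "\<dots> \<le> avg (\<lambda>f. 2 * \<bar>cond Y (\<alpha> m) f - avg (\<alpha> m)\<bar> + avg (\<alpha> m) * D m f)"
    proof (rule avg_mono)
      fix f assume f: "f \<in> oracles"
      have "D m f * (cond Y (\<alpha> m) f - avg (\<alpha> m)) \<le> D m f * \<bar>cond Y (\<alpha> m) f - avg (\<alpha> m)\<bar>"
        by (intro mult_left_mono D_nn) simp
      also have "\<dots> \<le> 2 * \<bar>cond Y (\<alpha> m) f - avg (\<alpha> m)\<bar>"
        by (intro mult_right_mono D_le f) simp
      finally show "D m f * cond Y (\<alpha> m) f \<le> 2 * \<bar>cond Y (\<alpha> m) f - avg (\<alpha> m)\<bar> + avg (\<alpha> m) * D m f"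
        by (simp add: algebra_simps)
    qed
    finally show "avg (\<lambda>f. D m f * \<alpha> m f) \<le> 2 * avg (\<lambda>f. \<bar>cond Y (\<alpha> m) f - avg (\<alpha> m)\<bar>) + avg (\<alpha> m) * avg (D m)"
      unfolding avg_add avg_cmult .
  qed
  also have "\<dots> = 2 * avg (\<lambda>f. \<Sum>m\<in>M. \<bar>cond Y (\<alpha> m) f - avg (\<alpha> m)\<bar>) + (\<Sum>m\<in>M. avg (\<alpha> m) * avg (D m))"
    by (simp add: sum.distrib avg_sum sum_distrib_left)
  finally show ?thesis unfolding D_def .
qed

lemma abs_avg_of_bool_le: "\<bar>avg (\<lambda>f. of_bool (P f))\<bar> \<le> 1"
  by (intro order_trans[OF abs_avg_le] avg_le_const) simp

lemma expectation_avg: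
  assumes "\<And>r f. \<bar>h r f\<bar> \<le> C"
  shows "measure_pmf.expectation p (\<lambda>r. avg (h r)) = avg (\<lambda>f. measure_pmf.expectation p (\<lambda>r. h r f))"
  unfolding avg_def
  by (subst Bochner_Integration.integral_divide_zero, subst Bochner_Integration.integral_sum)
    (auto intro: integrable_pmf_bounded assms)

text \<open>The bound of \<open>swap_error\<close> averaged over the coins. A point lies in
  \<open>Y s\<close> with probability at most \<delta>, and a point outside \<open>Q m\<close> lies
  in \<open>X r\<close> with probability at most \<delta> given the message \<open>m\<close>, so
  each family of increments contributes at most \<open>\<delta> * L\<close>. The factor 3 is 2 for
  decoupling the first message and 1 for the second.\<close>

lemma expected_swap_error:
  fixes pA :: "'r pmf" and pB :: "'s pmf"
    and A :: "'r \<Rightarrow> ('x \<Rightarrow> 'v) \<Rightarrow> 'm" and B :: "'s \<Rightarrow> 'm \<Rightarrow> ('x \<Rightarrow> 'v) \<Rightarrow> 'w"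
  assumes M: "finite M" "\<And>r f. f \<in> oracles \<Longrightarrow> A r f \<in> M"
    and W: "finite W" "\<And>s m f. f \<in> oracles \<Longrightarrow> B s m f \<in> W"
    and A: "\<And>r. depends (X r) (A r)" and B: "\<And>s m. depends (Y s) (B s m)"
    and a: "\<And>r m v f. 0 \<le> a r m v f" "\<And>r m v f. a r m v f \<le> 1"
      "\<And>r m v. depends (X r \<union> Q m) (a r m v)"
  defines "\<alpha> \<equiv> \<lambda>r m f. of_bool (A r f = m) :: real"
    and "p \<equiv> \<lambda>s m v f. of_bool (B s m f = v) :: real"
  assumes Y: "\<And>x. x \<in> N \<Longrightarrow> measure_pmf.prob pB {s. x \<in> Y s} \<le> \<delta>"
    and Q: "\<And>m x. x \<in> N - Q m \<Longrightarrow> measure_pmf.expectation pA (\<lambda>r. avg (\<alpha> r m) * of_bool (x \<in> X r))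
         \<le> \<delta> * measure_pmf.expectation pA (\<lambda>r. avg (\<alpha> r m))"
    and L: "ln (card M) \<le> L" "ln (card W) \<le> L" and \<tau>: "\<tau> > 0" and \<delta>: "\<delta> \<ge> 0"
  shows "\<bar>measure_pmf.expectation pA (\<lambda>r. measure_pmf.expectation pB (\<lambda>s.
      (\<Sum>m\<in>M. \<Sum>v\<in>W. avg (\<lambda>f. \<alpha> r m f * a r m v f * p s m v f)) -
      (\<Sum>m\<in>M. \<Sum>v\<in>W. avg (\<lambda>f. \<alpha> r m f * a r m v f * cond (Q m) (p s m v) f))))\<bar>
    \<le> 3 * (\<delta> * L / (2 * \<tau>) + 2 * \<tau>)"
    (is "\<bar>measure_pmf.expectation pA (\<lambda>r. measure_pmf.expectation pB (?g r))\<bar> \<le> _")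
proof -
  have one: "(\<Sum>m\<in>M. avg (\<alpha> r m)) = 1" for r
  proof -
    obtain f where "f \<in> oracles" using oracles_nonempty by auto
    then show ?thesis
      using sum_cond_indicator[of M "A r" f "{}"] M by (simp add: \<alpha>_def)
  qed
  have imA: "A r ` oracles \<subseteq> M" and imB: "B s m ` oracles \<subseteq> W" for r s m
    using M(2) W(2) by auto
  define PA where "PA r D \<longleftrightarrow> (\<forall>x. 0 \<le> D x) \<and> (\<Sum>x\<in>N - {}. D x) \<le> ln (card M) \<and>
      (\<forall>X \<tau>. \<tau> > 0 \<longrightarrow> avg (\<lambda>f. \<Sum>m\<in>M. \<bar>cond (X \<union> {}) (\<alpha> r m) f - cond {} (\<alpha> r m) f\<bar>)
        \<le> (\<Sum>x\<in>X \<inter> (N - {}). D x) / (2 * \<tau>) + 2 * \<tau>)" for r D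
  define PB where "PB s m D \<longleftrightarrow> (\<forall>x. 0 \<le> D x) \<and> (\<Sum>x\<in>N - Q m. D x) \<le> ln (card W) \<and>
      (\<forall>X \<tau>. \<tau> > 0 \<longrightarrow> avg (\<lambda>f. \<Sum>v\<in>W. \<bar>cond (X \<union> Q m) (p s m v) f - cond (Q m) (p s m v) f\<bar>)
        \<le> (\<Sum>x\<in>X \<inter> (N - Q m). D x) / (2 * \<tau>) + 2 * \<tau>)" for s m D
  \<comment> \<open>The increments are chosen as functions of one party's coins only, so they can be
    averaged independently of the query set of the other party.\<close>
  define DA where "DA r = (SOME D. PA r D)" for r
  define DB where "DB s m = (SOME D. PB s m D)" for s m
  have "PA r (DA r)" for r
    unfolding DA_def
    by (rule someI_ex[of "PA r"]) (unfold PA_def \<alpha>_def, rule decoupling[OF M(1) imA])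
  then have DA: "\<And>r x. 0 \<le> DA r x" "\<And>r. (\<Sum>x\<in>N. DA r x) \<le> L"
    "\<And>r X. avg (\<lambda>f. \<Sum>m\<in>M. \<bar>cond X (\<alpha> r m) f - avg (\<alpha> r m)\<bar>)
        \<le> (\<Sum>x\<in>X \<inter> N. DA r x) / (2 * \<tau>) + 2 * \<tau>"
    using \<tau> L(1) order_trans unfolding PA_def Diff_empty Un_empty_right cond_empty by blast+
  have "PB s m (DB s m)" for s m
    unfolding DB_def
    by (rule someI_ex[of "PB s m"]) (unfold PB_def p_def, rule decoupling[OF W(1) imB])
  then have DB: "\<And>s m x. 0 \<le> DB s m x" "\<And>s m. (\<Sum>x\<in>N - Q m. DB s m x) \<le> L"
    "\<And>s m X. avg (\<lambda>f. \<Sum>v\<in>W. \<bar>cond (X \<union> Q m) (p s m v) f - cond (Q m) (p s m v) f\<bar>)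
        \<le> (\<Sum>x\<in>X \<inter> (N - Q m). DB s m x) / (2 * \<tau>) + 2 * \<tau>"
    using \<tau> L(2) order_trans unfolding PB_def by blast+
  define u where "u r m x = avg (\<alpha> r m) * of_bool (x \<in> X r)" for r m x
  define bnd where "bnd r s = (\<Sum>x\<in>N. DA r x * of_bool (x \<in> Y s)) / \<tau> +
     (\<Sum>m\<in>M. \<Sum>x\<in>N - Q m. u r m x * DB s m x) / (2 * \<tau>) + 6 * \<tau>" for r s
  have \<alpha>_nn: "0 \<le> avg (\<alpha> r m)" for r m
    by (intro avg_nonneg) (simp add: \<alpha>_def)
  have split: "(\<Sum>m\<in>M. avg (\<alpha> r m) * (t m / (2 * \<tau>) + 2 * \<tau>)) =
      (\<Sum>m\<in>M. avg (\<alpha> r m) * t m) / (2 * \<tau>) + 2 * \<tau>" for r t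
    by (simp add: distrib_left sum.distrib sum_distrib_right[symmetric] one sum_divide_distrib)
  have g_le: "\<bar>?g r s\<bar> \<le> bnd r s" for r s
  proof -
    have "\<bar>?g r s\<bar> \<le> 2 * avg (\<lambda>f. \<Sum>m\<in>M. \<bar>cond (Y s) (\<alpha> r m) f - avg (\<alpha> r m)\<bar>) +
      (\<Sum>m\<in>M. avg (\<alpha> r m) * avg (\<lambda>f. \<Sum>v\<in>W. \<bar>cond (X r \<union> Q m) (p s m v) f - cond (Q m) (p s m v) f\<bar>))"
      unfolding \<alpha>_def p_def by (rule swap_error) (use M W A B a in auto)
    also have "\<dots> \<le> 2 * ((\<Sum>x\<in>Y s \<inter> N. DA r x) / (2 * \<tau>) + 2 * \<tau>) +
      (\<Sum>m\<in>M. avg (\<alpha> r m) * ((\<Sum>x\<in>X r \<inter> (N - Q m). DB s m x) / (2 * \<tau>) + 2 * \<tau>))"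
      by (intro add_mono mult_left_mono DA DB sum_mono \<alpha>_nn) simp
    also have "\<dots> = (\<Sum>x\<in>Y s \<inter> N. DA r x) / \<tau> +
       (\<Sum>m\<in>M. avg (\<alpha> r m) * (\<Sum>x\<in>X r \<inter> (N - Q m). DB s m x)) / (2 * \<tau>) + 6 * \<tau>"
      unfolding split using \<tau> by (simp add: distrib_left)
    also have "(\<Sum>x\<in>Y s \<inter> N. DA r x) = (\<Sum>x\<in>N. DA r x * of_bool (x \<in> Y s))"
      using finite_N by (simp add: of_bool_def sum.If_cases if_distrib[of "\<lambda>t. _ * t"] Int_commute cong: if_cong)
    also have "(\<Sum>m\<in>M. avg (\<alpha> r m) * (\<Sum>x\<in>X r \<inter> (N - Q m). DB s m x)) =
        (\<Sum>m\<in>M. \<Sum>x\<in>N - Q m. u r m x * DB s m x)"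
    proof (rule sum.cong[OF refl])
      fix m
      have "(\<Sum>x\<in>X r \<inter> (N - Q m). DB s m x) = (\<Sum>x\<in>N - Q m. of_bool (x \<in> X r) * DB s m x)"
        using finite_N
        by (simp add: of_bool_def sum.If_cases if_distrib[of "\<lambda>t. t * _"] Int_commute cong: if_cong)
      then show "avg (\<alpha> r m) * (\<Sum>x\<in>X r \<inter> (N - Q m). DB s m x) = (\<Sum>x\<in>N - Q m. u r m x * DB s m x)"
        by (simp add: u_def sum_distrib_left mult.assoc)
    qed
    finally show ?thesis by (simp add: bnd_def)
  qed
  have DB_le: "\<bar>DB s m x\<bar> \<le> L" if "x \<in> N - Q m" for s m x
  proof -
    have "DB s m x \<le> (\<Sum>x\<in>N - Q m. DB s m x)"
      using that finite_N DB(1) by (intro member_le_sum) auto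
    also have "\<dots> \<le> L" by (rule DB(2))
    finally show ?thesis using DB(1) by simp
  qed
  have iDB: "integrable (measure_pmf pB) (\<lambda>s. DB s m x)" if "x \<in> N - Q m" for m x
    by (rule integrable_pmf_bounded) (rule DB_le[OF that])
  have iY: "integrable (measure_pmf pB) (\<lambda>s. of_bool (x \<in> Y s) :: real)" for x
    by (rule integrable_pmf_bounded[where C = 1]) simp
  have iu: "integrable (measure_pmf pA) (\<lambda>r. u r m x)" for m x
    unfolding u_def \<alpha>_def
    by (rule integrable_pmf_bounded[where C = 1]) (use abs_avg_of_bool_le in auto)
  have i\<alpha>: "integrable (measure_pmf pA) (\<lambda>r. avg (\<alpha> r m))" for m
    unfolding \<alpha>_def by (rule integrable_pmf_bounded[where C = 1]) (use abs_avg_of_bool_le in auto)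
  define e where "e m x = measure_pmf.expectation pB (\<lambda>s. DB s m x)" for m x
  have e_nn: "0 \<le> e m x" for m x
    unfolding e_def by (intro Bochner_Integration.integral_nonneg DB)
  have sum_e: "(\<Sum>x\<in>N - Q m. e m x) \<le> L" for m
  proof -
    have "(\<Sum>x\<in>N - Q m. e m x) = measure_pmf.expectation pB (\<lambda>s. \<Sum>x\<in>N - Q m. DB s m x)"
      unfolding e_def by (rule Bochner_Integration.integral_sum[symmetric]) (rule iDB)
    also have "\<dots> \<le> measure_pmf.expectation pB (\<lambda>_. L)"
      by (intro expectation_mono Bochner_Integration.integrable_sum iDB DB(2)) auto
    finally show ?thesis by simp
  qed
  define b where "b r = \<delta> * L / \<tau> + (\<Sum>m\<in>M. \<Sum>x\<in>N - Q m. u r m x * e m x) / (2 * \<tau>) + 6 * \<tau>" for r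
  have ibnd: "integrable (measure_pmf pB) (bnd r)" for r
    unfolding bnd_def
    by (intro Bochner_Integration.integrable_add Bochner_Integration.integrable_divide_zero Bochner_Integration.integrable_sum
        Bochner_Integration.integrable_mult_right iDB iY) auto
  have bnd_b: "measure_pmf.expectation pB (bnd r) \<le> b r" for r
  proof -
    define T1 where "T1 s = (\<Sum>x\<in>N. DA r x * of_bool (x \<in> Y s))" for s
    define T2 where "T2 s = (\<Sum>m\<in>M. \<Sum>x\<in>N - Q m. u r m x * DB s m x)" for s
    have i: "integrable (measure_pmf pB) T1" "integrable (measure_pmf pB) T2"
      unfolding T1_def T2_def
      by (intro Bochner_Integration.integrable_sum Bochner_Integration.integrable_mult_right iDB iY; simp)+
    have T1: "measure_pmf.expectation pB T1 = (\<Sum>x\<in>N. DA r x * measure_pmf.prob pB {s. x \<in> Y s})"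
      unfolding T1_def
      by (subst Bochner_Integration.integral_sum)
        (simp_all only: integral_mult_right_zero expectation_of_bool_mem Bochner_Integration.integrable_mult_right iY)
    have T2: "measure_pmf.expectation pB T2 = (\<Sum>m\<in>M. \<Sum>x\<in>N - Q m. u r m x * e m x)"
      unfolding T2_def e_def
      by (subst Bochner_Integration.integral_sum)
        (auto intro!: sum.cong Bochner_Integration.integrable_sum Bochner_Integration.integrable_mult_right iDB
           simp: Bochner_Integration.integral_sum iDB)
    have "measure_pmf.expectation pB (bnd r) =
        measure_pmf.expectation pB T1 / \<tau> + measure_pmf.expectation pB T2 / (2 * \<tau>) + 6 * \<tau>"
      unfolding bnd_def T1_def[symmetric] T2_def[symmetric] using i by simp
    also note T1
    also note T2
    also have "(\<Sum>x\<in>N. DA r x * measure_pmf.prob pB {s. x \<in> Y s}) \<le> (\<Sum>x\<in>N. DA r x * \<delta>)"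
      by (intro sum_mono mult_left_mono Y DA)
    also have "\<dots> \<le> \<delta> * L"
      unfolding mult.commute[of _ \<delta>] sum_distrib_left[symmetric] by (rule mult_left_mono[OF DA(2) \<delta>])
    finally show ?thesis unfolding b_def using \<tau> by (simp add: divide_right_mono)
  qed
  have ib: "integrable (measure_pmf pA) b"
    unfolding b_def
    by (intro Bochner_Integration.integrable_add Bochner_Integration.integrable_divide_zero Bochner_Integration.integrable_sum
        Bochner_Integration.integrable_mult_left iu) auto
  have "\<bar>measure_pmf.expectation pB (?g r)\<bar> \<le> b r" for r
    using abs_expectation_le_expectation[OF ibnd g_le] bnd_b by (rule order_trans)
  then have "\<bar>measure_pmf.expectation pA (\<lambda>r. measure_pmf.expectation pB (?g r))\<bar> \<le> measure_pmf.expectation pA b"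
    by (intro abs_expectation_le_expectation ib)
  also have "\<dots> = \<delta> * L / \<tau> + (\<Sum>m\<in>M. \<Sum>x\<in>N - Q m. measure_pmf.expectation pA (\<lambda>r. u r m x) * e m x) / (2 * \<tau>) + 6 * \<tau>"
    unfolding b_def
    by (simp add: Bochner_Integration.integral_add Bochner_Integration.integral_sum iu)
  \<comment> \<open>The hypothesis on \<open>Q\<close> gives a factor \<delta> at each point, the
    increments \<open>e m x\<close> for one \<open>m\<close> sum to at most \<open>L\<close>, and
    the probabilities of the first messages sum to 1.\<close>
  also have "\<dots> \<le> \<delta> * L / \<tau> + \<delta> * L / (2 * \<tau>) + 6 * \<tau>"
  proof -
    have "(\<Sum>m\<in>M. \<Sum>x\<in>N - Q m. measure_pmf.expectation pA (\<lambda>r. u r m x) * e m x)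
        \<le> (\<Sum>m\<in>M. \<Sum>x\<in>N - Q m. \<delta> * measure_pmf.expectation pA (\<lambda>r. avg (\<alpha> r m)) * e m x)"
      unfolding u_def by (intro sum_mono mult_right_mono Q e_nn)
    also have "\<dots> = (\<Sum>m\<in>M. \<delta> * measure_pmf.expectation pA (\<lambda>r. avg (\<alpha> r m)) * (\<Sum>x\<in>N - Q m. e m x))"
      by (simp add: sum_distrib_left)
    also have "\<dots> \<le> (\<Sum>m\<in>M. \<delta> * measure_pmf.expectation pA (\<lambda>r. avg (\<alpha> r m)) * L)"
      by (intro sum_mono mult_left_mono sum_e mult_nonneg_nonneg \<delta> Bochner_Integration.integral_nonneg \<alpha>_nn)
    also have "\<dots> = \<delta> * L * measure_pmf.expectation pA (\<lambda>r. \<Sum>m\<in>M. avg (\<alpha> r m))"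
      by (simp add: Bochner_Integration.integral_sum i\<alpha> sum_distrib_left mult_ac)
    finally have "(\<Sum>m\<in>M. \<Sum>x\<in>N - Q m. measure_pmf.expectation pA (\<lambda>r. u r m x) * e m x) \<le> \<delta> * L"
      by (simp add: one)
    then show ?thesis
      using \<tau> by (intro add_mono divide_right_mono) auto
  qed
  also have "\<dots> = 3 * (\<delta> * L / (2 * \<tau>) + 2 * \<tau>)"
    by (simp add: field_simps)
  finally show ?thesis .
qed

section \<open>Guessing the likelier output\<close>

text \<open>A parameter that is known from the answers on \<open>S\<close> stays constant under
  resampling and may be fixed first.\<close>

lemma cond_select:
  assumes "depends S k" "f \<in> oracles"
  shows "cond S (\<lambda>g. h (k g) g) f = cond S (h (k f)) f"
  unfolding cond_def by (intro avg_cong) (simp add: depends_patch[OF assms(1) assms(2)])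

text \<open>For each oracle only the pair of \<open>m = A f\<close> and \<open>v = B m f\<close>
  contributes to the double sum.\<close>

lemma avg_collapse:
  fixes A :: "('x \<Rightarrow> 'v) \<Rightarrow> 'm" and B :: "'m \<Rightarrow> ('x \<Rightarrow> 'v) \<Rightarrow> 'w"
  assumes M: "finite M" "\<And>f. f \<in> oracles \<Longrightarrow> A f \<in> M"
    and W: "finite W" "\<And>m f. f \<in> oracles \<Longrightarrow> B m f \<in> W"
  shows "(\<Sum>m\<in>M. \<Sum>v\<in>W. avg (\<lambda>f. of_bool (A f = m) * a m v f * of_bool (B m f = v))) =
    avg (\<lambda>f. a (A f) (B (A f) f) f)"
proof -
  have "(\<Sum>m\<in>M. \<Sum>v\<in>W. of_bool (A f = m) * a m v f * of_bool (B m f = v)) = a (A f) (B (A f) f) f"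
    if f: "f \<in> oracles" for f
  proof -
    have "(\<Sum>v\<in>W. of_bool (A f = m) * a m v f * of_bool (B m f = v)) = of_bool (A f = m) * a m (B m f) f" for m
      using W f by (simp add: of_bool_def if_distrib[of "\<lambda>t. _ * t"] cong: if_cong)
    then show ?thesis
      using M f by (simp add: of_bool_def if_distrib[of "\<lambda>t. t * _"] cong: if_cong)
  qed
  then show ?thesis
    unfolding avg_sum[symmetric] by (rule avg_cong)
qed

lemma expectation_avg_mult:
  assumes x: "\<And>r f. \<bar>x r f\<bar> \<le> 1" and y: "\<And>s f. \<bar>y s f\<bar> \<le> 1"
  shows "measure_pmf.expectation pA (\<lambda>r. measure_pmf.expectation pB (\<lambda>s. avg (\<lambda>f. x r f * y s f))) =
    avg (\<lambda>f. measure_pmf.expectation pA (\<lambda>r. x r f) * measure_pmf.expectation pB (\<lambda>s. y s f))"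
proof -
  have "measure_pmf.expectation pB (\<lambda>s. avg (\<lambda>f. x r f * y s f)) =
      avg (\<lambda>f. x r f * measure_pmf.expectation pB (\<lambda>s. y s f))" for r
    by (subst expectation_avg[where C = 1]) (simp_all add: abs_mult_le_one x y)
  moreover have "measure_pmf.expectation pA (\<lambda>r. avg (\<lambda>f. x r f * measure_pmf.expectation pB (\<lambda>s. y s f))) =
      avg (\<lambda>f. measure_pmf.expectation pA (\<lambda>r. x r f) * measure_pmf.expectation pB (\<lambda>s. y s f))"
    by (subst expectation_avg[where C = 1]) (simp_all add: abs_mult_le_one x y abs_expectation_le)
  ultimately show ?thesis by simp
qed

text \<open>For a fixed oracle, a joint probability over Alice's coins. It is not divided by the
  probability of \<open>m\<close>, which would not affect the comparison of the two bits.\<close>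

definition answer_weight ::
    "'r pmf \<Rightarrow> ('r \<Rightarrow> ('x \<Rightarrow> 'v) \<Rightarrow> 'm) \<Rightarrow> ('r \<Rightarrow> 'm \<Rightarrow> 'c \<Rightarrow> ('x \<Rightarrow> 'v) \<Rightarrow> bool) \<Rightarrow>
      'm \<Rightarrow> 'c \<Rightarrow> bool \<Rightarrow> ('x \<Rightarrow> 'v) \<Rightarrow> real" where
  "answer_weight pA A out m c b f = measure_pmf.expectation pA (\<lambda>r. of_bool (A r f = m) * of_bool (out r m c f = b))"

text \<open>The maximum-likelihood guess from the answers on \<open>Q\<close>; ties go to
  \<open>True\<close>.\<close>

definition likelier ::
    "'r pmf \<Rightarrow> ('r \<Rightarrow> ('x \<Rightarrow> 'v) \<Rightarrow> 'm) \<Rightarrow> ('r \<Rightarrow> 'm \<Rightarrow> 'c \<Rightarrow> ('x \<Rightarrow> 'v) \<Rightarrow> bool) \<Rightarrow>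
      'x set \<Rightarrow> 'm \<Rightarrow> 'c \<Rightarrow> ('x \<Rightarrow> 'v) \<Rightarrow> bool" where
  "likelier pA A out Q m c f \<longleftrightarrow>
     cond Q (answer_weight pA A out m c False) f \<le> cond Q (answer_weight pA A out m c True) f"

lemma depends_likelier: "depends Q (likelier pA A out Q m c)"
  unfolding likelier_def by (rule depends_comp2; rule depends_cond)

lemma cond_answer_weight_le_likelier:
  assumes "f \<in> oracles"
  shows "cond Q (answer_weight pA A out m c b) f
    \<le> cond Q (\<lambda>g. answer_weight pA A out m c (likelier pA A out Q m c g) g) f"
  unfolding cond_select[OF depends_likelier assms]
  by (cases b; cases "likelier pA A out Q m c f") (auto simp: likelier_def)

text \<open>If the two outputs were independent given what the eavesdropper sees, guessing the likelier
  value of the first one would succeed at least as often as they agree. The swap error measures the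
  distance to that situation; it is paid twice, once for each side of the comparison.\<close>

lemma eavesdropper_success:
  fixes pA :: "'r pmf" and pB :: "'s pmf"
    and A :: "'r \<Rightarrow> ('x \<Rightarrow> 'v) \<Rightarrow> 'm" and B :: "'s \<Rightarrow> 'm \<Rightarrow> ('x \<Rightarrow> 'v) \<Rightarrow> 'c \<times> bool"
    and out :: "'r \<Rightarrow> 'm \<Rightarrow> 'c \<Rightarrow> ('x \<Rightarrow> 'v) \<Rightarrow> bool"
  assumes M: "finite M" "\<And>r f. f \<in> oracles \<Longrightarrow> A r f \<in> M"
    and W: "finite W" "\<And>s m f. f \<in> oracles \<Longrightarrow> B s m f \<in> W"
    and A: "\<And>r. depends (X r) (A r)" and B: "\<And>s m. depends (Y s) (B s m)"
    and out: "\<And>r m c. depends (X r) (out r m c)"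
    and Y: "\<And>x. x \<in> N \<Longrightarrow> measure_pmf.prob pB {s. x \<in> Y s} \<le> \<delta>"
    and Q: "\<And>m x. x \<in> N - Q m \<Longrightarrow>
         measure_pmf.expectation pA (\<lambda>r. avg (\<lambda>f. of_bool (A r f = m)) * of_bool (x \<in> X r))
         \<le> \<delta> * measure_pmf.expectation pA (\<lambda>r. avg (\<lambda>f. of_bool (A r f = m)))"
    and L: "ln (card M) \<le> L" "ln (card W) \<le> L" and \<tau>: "\<tau> > 0" and \<delta>: "\<delta> \<ge> 0"
  shows "measure_pmf.expectation pA (\<lambda>r. measure_pmf.expectation pB (\<lambda>s. avg (\<lambda>f.
      let m = A r f; (c, b) = B s m f in of_bool (out r m c f = b))) ) - 6 * (\<delta> * L / (2 * \<tau>) + 2 * \<tau>)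
    \<le> measure_pmf.expectation pA (\<lambda>r. measure_pmf.expectation pB (\<lambda>s. avg (\<lambda>f.
      let m = A r f; (c, b) = B s m f in of_bool (out r m c f = likelier pA A out (Q m) m c f))))"
proof -
  define p where "p s m v f = (of_bool (B s m f = v) :: real)" for s m v f
  \<comment> \<open>\<open>R\<close> is the real execution. In \<open>I\<close> the indicator of
    Bob's message and output is replaced by its conditional mean given the eavesdropper's answers on
    \<open>Q m\<close>.\<close>
  define R where "R a r s = (\<Sum>m\<in>M. \<Sum>v\<in>W. avg (\<lambda>f. of_bool (A r f = m) * a r m v f * p s m v f))"
    for a :: "'r \<Rightarrow> 'm \<Rightarrow> 'c \<times> bool \<Rightarrow> ('x \<Rightarrow> 'v) \<Rightarrow> real" and r s
  define I where "I a r s = (\<Sum>m\<in>M. \<Sum>v\<in>W. avg (\<lambda>f. of_bool (A r f = m) * a r m v f * cond (Q m) (p s m v) f))"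
    for a :: "'r \<Rightarrow> 'm \<Rightarrow> 'c \<times> bool \<Rightarrow> ('x \<Rightarrow> 'v) \<Rightarrow> real" and r s
  define E where "E h = measure_pmf.expectation pA (\<lambda>r. measure_pmf.expectation pB (h r))" for h :: "'r \<Rightarrow> 's \<Rightarrow> real"
  define err where "err = 3 * (\<delta> * L / (2 * \<tau>) + 2 * \<tau>)"
  define q where "q m v f = measure_pmf.expectation pB (\<lambda>s. cond (Q m) (p s m v) f)" for m v f
  have p01: "\<bar>p s m v f\<bar> \<le> 1" "\<bar>cond S (p s m v) f\<bar> \<le> 1" for S s m v f
    by (auto simp: p_def cond_def intro: abs_avg_of_bool_le)
  have close: "\<bar>E (R a) - E (I a)\<bar> \<le> err"
    and ideal: "E (I a) = (\<Sum>m\<in>M. \<Sum>v\<in>W. avg (\<lambda>f. measure_pmf.expectation pA (\<lambda>r. of_bool (A r f = m) * a r m v f) * q m v f))"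
    if a: "\<And>r m v f. 0 \<le> a r m v f" "\<And>r m v f. a r m v f \<le> 1" "\<And>r m v. depends (X r \<union> Q m) (a r m v)" for a
  proof -
    have x01: "\<bar>of_bool (A r f = m) * a r m v f\<bar> \<le> 1" for r m v f
      using a(1,2)[of r m v f] by simp
    have xy: "\<bar>of_bool (A r f = m) * a r m v f * t\<bar> \<le> 1" if "\<bar>t\<bar> \<le> 1" for r m v f t
      by (rule abs_mult_le_one[OF x01 that])
    have avg1: "\<bar>avg h\<bar> \<le> 1" if "\<And>f. \<bar>h f\<bar> \<le> 1" for h
      by (intro order_trans[OF abs_avg_le] avg_le_const that)
    have iB: "integrable (measure_pmf pB) (\<lambda>s. avg (\<lambda>f. of_bool (A r f = m) * a r m v f * p s m v f))"
      "integrable (measure_pmf pB) (\<lambda>s. avg (\<lambda>f. of_bool (A r f = m) * a r m v f * cond (Q m) (p s m v) f))" for r m v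
      by (rule integrable_pmf_bounded[where C = 1], rule avg1, rule xy, rule p01)+
    have iA: "integrable (measure_pmf pA) (\<lambda>r. measure_pmf.expectation pB (\<lambda>s. avg (\<lambda>f. of_bool (A r f = m) * a r m v f * p s m v f)))"
      "integrable (measure_pmf pA) (\<lambda>r. measure_pmf.expectation pB (\<lambda>s. avg (\<lambda>f. of_bool (A r f = m) * a r m v f * cond (Q m) (p s m v) f)))" for m v
      by (rule integrable_pmf_bounded[where C = 1], rule abs_expectation_le, rule avg1, rule xy, rule p01)+
    have inner: "measure_pmf.expectation pB (R a r) =
        (\<Sum>m\<in>M. \<Sum>v\<in>W. measure_pmf.expectation pB (\<lambda>s. avg (\<lambda>f. of_bool (A r f = m) * a r m v f * p s m v f)))"
      "measure_pmf.expectation pB (I a r) =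
        (\<Sum>m\<in>M. \<Sum>v\<in>W. measure_pmf.expectation pB (\<lambda>s. avg (\<lambda>f. of_bool (A r f = m) * a r m v f * cond (Q m) (p s m v) f)))" for r
      unfolding R_def I_def
      by (simp_all add: Bochner_Integration.integral_sum Bochner_Integration.integrable_sum iB)
    have "integrable (measure_pmf pB) (R a r)" "integrable (measure_pmf pB) (I a r)" for r
      unfolding R_def I_def by (intro Bochner_Integration.integrable_sum iB)+
    moreover have "integrable (measure_pmf pA) (\<lambda>r. measure_pmf.expectation pB (R a r))"
      "integrable (measure_pmf pA) (\<lambda>r. measure_pmf.expectation pB (I a r))"
      unfolding inner by (intro Bochner_Integration.integrable_sum iA)+
    ultimately have "E (\<lambda>r s. R a r s - I a r s) = E (R a) - E (I a)"
      unfolding E_def by simp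
    moreover have "\<bar>E (\<lambda>r s. R a r s - I a r s)\<bar> \<le> err"
      unfolding E_def R_def I_def p_def err_def
      by (rule expected_swap_error[where X = X and Y = Y]) (use M W A B a Y Q L \<tau> \<delta> in auto)
    ultimately show "\<bar>E (R a) - E (I a)\<bar> \<le> err" by simp
    have "E (I a) = (\<Sum>m\<in>M. \<Sum>v\<in>W. measure_pmf.expectation pA (\<lambda>r. measure_pmf.expectation pB
        (\<lambda>s. avg (\<lambda>f. of_bool (A r f = m) * a r m v f * cond (Q m) (p s m v) f))))"
      unfolding E_def inner by (simp add: Bochner_Integration.integral_sum Bochner_Integration.integrable_sum iA)
    also have "\<dots> = (\<Sum>m\<in>M. \<Sum>v\<in>W. avg (\<lambda>f. measure_pmf.expectation pA (\<lambda>r. of_bool (A r f = m) * a r m v f) * q m v f))"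
      unfolding q_def by (intro sum.cong refl expectation_avg_mult x01 p01)
    finally show "E (I a) = \<dots>" .
  qed
  \<comment> \<open>\<open>a1\<close> tests agreement with Bob's output, the second component of
    \<open>v\<close>, and \<open>a2\<close> tests the eavesdropper's guess.\<close>
  define a1 where "a1 r m v f = (of_bool (out r m (fst v) f = snd v) :: real)" for r m v f
  define a2 where "a2 r m v f = (of_bool (out r m (fst v) f = likelier pA A out (Q m) m (fst v) f) :: real)"
    for r m f and v :: "'c \<times> bool"
  have dep1: "depends (X r \<union> Q m) (a1 r m v)" for r m v
    unfolding a1_def by (rule depends_comp[OF depends_mono[OF out]]) simp
  have dep2: "depends (X r \<union> Q m) (a2 r m v)" for r m v
    unfolding a2_def by (rule depends_comp2; rule depends_mono[OF out] depends_mono[OF depends_likelier]; simp)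
  have q_nn: "0 \<le> q m v f" if "f \<in> oracles" for m v f
    unfolding q_def p_def by (intro Bochner_Integration.integral_nonneg cond_nonneg that) simp
  have q_dep: "depends (Q m) (q m v)" for m v
    unfolding depends_def
  proof (intro ballI impI)
    fix f g assume fg: "f \<in> oracles" "g \<in> oracles" "\<forall>x\<in>Q m. f x = g x"
    have "cond (Q m) (p s m v) f = cond (Q m) (p s m v) g" for s
      using depends_cond[of "Q m" "p s m v"] fg unfolding depends_def by blast
    then show "q m v f = q m v g" by (simp add: q_def)
  qed
  \<comment> \<open>In the ideal expression Bob enters only through \<open>q m v\<close>, which is
    known from \<open>Q m\<close>. Alice's weight may thus be replaced by its conditional mean given
    \<open>Q m\<close>, and there the likelier bit is optimal.\<close>
  have "E (I a1) \<le> E (I a2)"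
  proof -
    have "avg (\<lambda>f. measure_pmf.expectation pA (\<lambda>r. of_bool (A r f = m) * a1 r m v f) * q m v f)
        \<le> avg (\<lambda>f. measure_pmf.expectation pA (\<lambda>r. of_bool (A r f = m) * a2 r m v f) * q m v f)" for m v
    proof -
      let ?g = "\<lambda>g. likelier pA A out (Q m) m (fst v) g"
      have "avg (\<lambda>f. measure_pmf.expectation pA (\<lambda>r. of_bool (A r f = m) * a1 r m v f) * q m v f)
          = avg (\<lambda>f. q m v f * answer_weight pA A out m (fst v) (snd v) f)"
        by (simp add: a1_def answer_weight_def mult.commute)
      also have "\<dots> = avg (\<lambda>f. q m v f * cond (Q m) (answer_weight pA A out m (fst v) (snd v)) f)"
        by (rule avg_pull[OF q_dep, symmetric])
      also have "\<dots> \<le> avg (\<lambda>f. q m v f * cond (Q m) (\<lambda>g. answer_weight pA A out m (fst v) (?g g) g) f)"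
        by (intro avg_mono mult_left_mono cond_answer_weight_le_likelier q_nn)
      also have "\<dots> = avg (\<lambda>f. q m v f * answer_weight pA A out m (fst v) (?g f) f)"
        by (rule avg_pull[OF q_dep])
      also have "\<dots> = avg (\<lambda>f. measure_pmf.expectation pA (\<lambda>r. of_bool (A r f = m) * a2 r m v f) * q m v f)"
        by (simp add: a2_def answer_weight_def mult.commute)
      finally show ?thesis .
    qed
    then show ?thesis
      by (subst (1 2) ideal) (auto intro!: sum_mono dep1 dep2 simp: a1_def a2_def)
  qed
  moreover have "\<bar>E (R a1) - E (I a1)\<bar> \<le> err"
    by (rule close) (auto intro: dep1 simp: a1_def)
  moreover have "\<bar>E (R a2) - E (I a2)\<bar> \<le> err"
    by (rule close) (auto intro: dep2 simp: a2_def)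
  ultimately have "E (R a1) - 2 * err \<le> E (R a2)" by linarith
  moreover have "R a = (\<lambda>r s. avg (\<lambda>f. a r (A r f) (B s (A r f) f) f))" for a
    unfolding R_def p_def by (intro ext avg_collapse) (use M W in auto)
  ultimately show ?thesis
    by (simp add: E_def a1_def a2_def err_def Let_def case_prod_unfold)
qed

section \<open>Heavy points\<close>

text \<open>The weight \<open>u\<close> biases the law of the coins, so the condition is a
  conditional probability above \<delta>. It is multiplied out: for nonnegative \<open>u\<close> of
  mean 0 the set is empty.\<close>

definition heavy :: "'r pmf \<Rightarrow> ('r \<Rightarrow> real) \<Rightarrow> ('r \<Rightarrow> 'x set) \<Rightarrow> real \<Rightarrow> 'x set" where
  "heavy p u X \<delta> = {x\<in>N. \<delta> * measure_pmf.expectation p u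
     < measure_pmf.expectation p (\<lambda>r. u r * of_bool (x \<in> X r))}"

text \<open>Double counting: weighted by \<open>u\<close>, the expected number of queried points is
  at most \<open>l\<close> times the mean of \<open>u\<close>, and each heavy point accounts for
  more than \<delta> times that mean.\<close>

lemma card_heavy_le:
  assumes u: "\<And>r. 0 \<le> u r" "\<And>r. u r \<le> 1" and \<delta>: "\<delta> > 0"
    and X: "\<And>r. r \<in> set_pmf p \<Longrightarrow> card (X r \<inter> N) \<le> l"
  shows "real (card (heavy p u X \<delta>)) \<le> l / \<delta>"
proof -
  define t where "t = measure_pmf.expectation p u"
  define w where "w x = measure_pmf.expectation p (\<lambda>r. u r * of_bool (x \<in> X r))" for x
  have iu: "integrable (measure_pmf p) u"
    using u by (intro integrable_pmf_bounded[where C = 1]) (simp add: abs_le_iff order_trans[of _ 0])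
  have iw: "integrable (measure_pmf p) (\<lambda>r. u r * of_bool (x \<in> X r))" for x
    by (rule integrable_pmf_dominated[OF iu]) (use u in auto)
  have w_le: "w x \<le> t" for x
    unfolding w_def t_def using u by (intro expectation_mono iu iw) auto
  have t: "t \<ge> 0" unfolding t_def using u by simp
  have fin: "finite (heavy p u X \<delta>)" unfolding heavy_def using finite_N by simp
  show ?thesis
  proof (cases "t = 0")
    case True
    then have "heavy p u X \<delta> = {}"
      using w_le by (auto simp: heavy_def t_def[symmetric] w_def[symmetric] not_less)
    then show ?thesis using \<delta> by simp
  next
    case False
    have "card (heavy p u X \<delta>) * (\<delta> * t) \<le> (\<Sum>x\<in>heavy p u X \<delta>. w x)"
      using sum_mono[of "heavy p u X \<delta>" "\<lambda>_. \<delta> * t" w] by (auto simp: heavy_def t_def w_def)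
    also have "\<dots> \<le> (\<Sum>x\<in>N. w x)"
      using finite_N u by (intro sum_mono2) (auto simp: heavy_def w_def)
    also have "\<dots> = measure_pmf.expectation p (\<lambda>r. \<Sum>x\<in>N. u r * of_bool (x \<in> X r))"
      unfolding w_def by (rule Bochner_Integration.integral_sum[symmetric]) (rule iw)
    also have "\<dots> \<le> measure_pmf.expectation p (\<lambda>r. l * u r)"
    proof (intro integral_mono_AE Bochner_Integration.integrable_sum iw Bochner_Integration.integrable_mult_right iu AE_pmfI)
      fix r assume r: "r \<in> set_pmf p"
      have "(\<Sum>x\<in>N. u r * of_bool (x \<in> X r)) = u r * card (X r \<inter> N)"
        using finite_N by (simp add: sum_distrib_left[symmetric] of_bool_def sum.If_cases Int_commute)
      also have "\<dots> \<le> u r * l"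
        using X[OF r] u by (intro mult_left_mono) auto
      finally show "(\<Sum>x\<in>N. u r * of_bool (x \<in> X r)) \<le> l * u r"
        by (simp add: mult.commute)
    qed
    also have "\<dots> = l * t" by (simp add: t_def)
    finally have "card (heavy p u X \<delta>) * \<delta> \<le> l"
      using False t by (simp add: mult.assoc[symmetric])
    then show ?thesis using \<delta> by (simp add: pos_le_divide_eq)
  qed
qed

section \<open>Freezing the answers on Bob's heavy points\<close>

lemma patch_patch_same [simp]: "patch H (patch H f g) h = patch H f h"
  by (auto simp: override_on_def)

text \<open>The second set of queries: the oracle is frozen to \<open>f\<close> on \<open>H\<close>,
  and the coins are weighted by the probability of sending \<open>m\<close>. Points of
  \<open>H\<close> are removed, as their answers are known already.\<close>

definition heavy_given ::
    "'r pmf \<Rightarrow> ('r \<Rightarrow> ('x \<Rightarrow> 'v) \<Rightarrow> 'm) \<Rightarrow> ('r \<Rightarrow> 'x set) \<Rightarrow> real \<Rightarrow> 'x set \<Rightarrow> ('x \<Rightarrow> 'v) \<Rightarrow> 'm \<Rightarrow> 'x set" where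
  "heavy_given pA A X \<delta> H f m =
     heavy pA (\<lambda>r. avg (\<lambda>g. of_bool (A r (patch H f g) = m))) (\<lambda>r. X r - H) \<delta>"

text \<open>Two oracle arguments keep the two rounds of queries apart: \<open>f\<close> supplies the
  answers on \<open>H\<close>, and \<open>h\<close> those on the second set, which itself depends on
  the first answers.\<close>

definition best_guess ::
    "'r pmf \<Rightarrow> ('r \<Rightarrow> ('x \<Rightarrow> 'v) \<Rightarrow> 'm) \<Rightarrow> ('r \<Rightarrow> 'm \<Rightarrow> 'c \<Rightarrow> ('x \<Rightarrow> 'v) \<Rightarrow> bool) \<Rightarrow> ('r \<Rightarrow> 'x set) \<Rightarrow>
      real \<Rightarrow> 'x set \<Rightarrow> 'm \<Rightarrow> 'c \<Rightarrow> ('x \<Rightarrow> 'v) \<Rightarrow> ('x \<Rightarrow> 'v) \<Rightarrow> bool" where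
  "best_guess pA A out X \<delta> H m c f h =
     likelier pA (\<lambda>r g. A r (patch H f g)) (\<lambda>r m c g. out r m c (patch H f g)) (heavy_given pA A X \<delta> H f m) m c h"

lemma heavy_given_disjoint: "\<delta> \<ge> 0 \<Longrightarrow> heavy_given pA A X \<delta> H f m \<inter> H = {}"
proof -
  assume "\<delta> \<ge> 0"
  moreover have "0 \<le> measure_pmf.expectation pA (\<lambda>r. avg (\<lambda>g. of_bool (A r (patch H f g) = m)))"
    by (intro Bochner_Integration.integral_nonneg avg_nonneg) simp
  ultimately have "0 \<le> \<delta> * measure_pmf.expectation pA (\<lambda>r. avg (\<lambda>g. of_bool (A r (patch H f g) = m)))"
    by (rule mult_nonneg_nonneg)
  then show ?thesis
    by (auto simp: heavy_given_def heavy_def)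
qed

lemma heavy_given_patch [simp]: "heavy_given pA A X \<delta> H (patch H f g) m = heavy_given pA A X \<delta> H f m"
  by (simp add: heavy_given_def)

text \<open>The guess uses nothing but the queried answers, so arbitrary values elsewhere do not
  change it.\<close>

lemma best_guess_patch:
  assumes "h \<in> oracles" "h' \<in> oracles" "\<And>x. x \<in> heavy_given pA A X \<delta> H f m \<Longrightarrow> h x = h' x"
  shows "best_guess pA A out X \<delta> H m c (patch H f g) h = best_guess pA A out X \<delta> H m c f h'"
  unfolding best_guess_def heavy_given_patch patch_patch_same
  by (rule dependsD[OF depends_likelier assms])

lemma depends_frozen:
  assumes "depends S h" "f \<in> oracles"
  shows "depends (S - H) (\<lambda>g. h (patch H f g))"
  unfolding depends_def
proof (intro ballI impI)
  fix g g' assume g: "g \<in> oracles" "g' \<in> oracles" "\<forall>x\<in>S - H. g x = g' x"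
  then have "\<forall>x\<in>S. patch H f g x = patch H f g' x" by (auto simp: override_on_def)
  then show "h (patch H f g) = h (patch H f g')"
    using assms g(1,2) by (intro dependsD[OF assms(1)]) auto
qed

text \<open>For each choice of the answers on \<open>H\<close>, the residual game on the other
  points has no point that Bob queries with probability above \<delta>, so
  \<open>eavesdropper_success\<close> applies to it; the results are then averaged over these
  answers.\<close>

lemma heavy_query_attack:
  fixes pA :: "'r pmf" and pB :: "'s pmf"
    and A :: "'r \<Rightarrow> ('x \<Rightarrow> 'v) \<Rightarrow> 'm" and B :: "'s \<Rightarrow> 'm \<Rightarrow> ('x \<Rightarrow> 'v) \<Rightarrow> 'c \<times> bool"
    and out :: "'r \<Rightarrow> 'm \<Rightarrow> 'c \<Rightarrow> ('x \<Rightarrow> 'v) \<Rightarrow> bool"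
  assumes M: "finite M" "\<And>r f. f \<in> oracles \<Longrightarrow> A r f \<in> M"
    and W: "finite W" "\<And>s m f. f \<in> oracles \<Longrightarrow> B s m f \<in> W"
    and A: "\<And>r. depends (X r) (A r)" and B: "\<And>s m. depends (Y s) (B s m)"
    and out: "\<And>r m c. depends (X r) (out r m c)"
    and L: "ln (card M) \<le> L" "ln (card W) \<le> L" and \<tau>: "\<tau> > 0" and \<delta>: "\<delta> \<ge> 0"
  defines "H \<equiv> heavy pB (\<lambda>_. 1) Y \<delta>"
  shows "measure_pmf.expectation pA (\<lambda>r. measure_pmf.expectation pB (\<lambda>s. avg (\<lambda>f.
      let m = A r f; (c, b) = B s m f in of_bool (out r m c f = b)))) - 6 * (\<delta> * L / (2 * \<tau>) + 2 * \<tau>)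
    \<le> measure_pmf.expectation pA (\<lambda>r. measure_pmf.expectation pB (\<lambda>s. avg (\<lambda>f.
      let m = A r f; (c, b) = B s m f in of_bool (out r m c f = best_guess pA A out X \<delta> H m c f f))))"
proof -
  define E where "E h = measure_pmf.expectation pA (\<lambda>r. measure_pmf.expectation pB (\<lambda>s. avg (h r s)))"
    for h :: "'r \<Rightarrow> 's \<Rightarrow> ('x \<Rightarrow> 'v) \<Rightarrow> real"
  define h1 where "h1 r s f = (let m = A r f; (c, b) = B s m f in of_bool (out r m c f = b) :: real)" for r s f
  define h2 where "h2 r s f =
    (let m = A r f; (c, b) = B s m f in of_bool (out r m c f = best_guess pA A out X \<delta> H m c f f) :: real)" for r s f
  let ?err = "6 * (\<delta> * L / (2 * \<tau>) + 2 * \<tau>)"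
  have split: "E h = avg (\<lambda>f. E (\<lambda>r s g. h r s (patch H f g)))"
    if "\<And>r s f. \<bar>h r s f\<bar> \<le> 1" for h :: "'r \<Rightarrow> 's \<Rightarrow> ('x \<Rightarrow> 'v) \<Rightarrow> real"
  proof -
    have c1: "\<bar>cond H (h r s) f\<bar> \<le> 1" for r s f
      unfolding cond_def by (intro order_trans[OF abs_avg_le] avg_le_const that)
    have "E h = E (\<lambda>r s. cond H (h r s))" by (simp add: E_def)
    also have "\<dots> = avg (\<lambda>f. measure_pmf.expectation pA (\<lambda>r. measure_pmf.expectation pB (\<lambda>s. cond H (h r s) f)))"
      unfolding E_def using c1 by (simp add: expectation_avg[where C = 1] abs_expectation_le del: avg_cond)
    finally show ?thesis by (simp add: cond_def E_def)
  qed
  have frozen: "E (\<lambda>r s g. h1 r s (patch H f g)) - ?err \<le> E (\<lambda>r s g. h2 r s (patch H f g))"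
    if f: "f \<in> oracles" for f
  proof -
    let ?A = "\<lambda>r g. A r (patch H f g)" and ?B = "\<lambda>s m g. B s m (patch H f g)"
      and ?out = "\<lambda>r m c g. out r m c (patch H f g)" and ?Q = "heavy_given pA A X \<delta> H f"
    have Y: "measure_pmf.prob pB {s. x \<in> Y s - H} \<le> \<delta>" if "x \<in> N" for x
    proof (cases "x \<in> H")
      case False
      then show ?thesis
        using that by (simp add: H_def heavy_def not_less expectation_of_bool_mem)
    qed (simp add: \<delta>)
    have Q: "measure_pmf.expectation pA (\<lambda>r. avg (\<lambda>g. of_bool (?A r g = m)) * of_bool (x \<in> X r - H))
         \<le> \<delta> * measure_pmf.expectation pA (\<lambda>r. avg (\<lambda>g. of_bool (?A r g = m)))" if "x \<in> N - ?Q m" for m x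
      using that unfolding heavy_given_def heavy_def by (auto simp: not_less)
    have "E (\<lambda>r s g. h1 r s (patch H f g)) - ?err \<le> E (\<lambda>r s g.
      let m = ?A r g; (c, b) = ?B s m g in of_bool (?out r m c g = likelier pA ?A ?out (?Q m) m c g))"
      unfolding E_def h1_def
      by (rule eavesdropper_success[where X = "\<lambda>r. X r - H" and Y = "\<lambda>s. Y s - H", OF M(1) _ W(1)])
        (use M(2) W(2) f Y Q L \<tau> \<delta> in \<open>auto intro: depends_frozen A B out\<close>)
    also have "\<dots> = E (\<lambda>r s g. h2 r s (patch H f g))"
    proof -
      \<comment> \<open>The second query set avoids \<open>H\<close>, so on it the patched oracle
        still shows the answers of \<open>g\<close>.\<close>
      have "likelier pA ?A ?out (?Q m) m c g = best_guess pA A out X \<delta> H m c (patch H f g) (patch H f g)"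
        if g: "g \<in> oracles" for m c g
      proof -
        have "best_guess pA A out X \<delta> H m c (patch H f g) (patch H f g) = best_guess pA A out X \<delta> H m c f g"
          using g f heavy_given_disjoint[OF \<delta>, of pA A X H f m]
          by (intro best_guess_patch patch_in_oracles) (auto simp: override_on_def)
        then show ?thesis by (simp add: best_guess_def)
      qed
      then have "avg (\<lambda>g. let m = ?A r g; (c, b) = ?B s m g in of_bool (?out r m c g = likelier pA ?A ?out (?Q m) m c g))
          = avg (\<lambda>g. h2 r s (patch H f g))" for r s
        by (intro avg_cong) (simp add: h2_def Let_def case_prod_unfold)
      then show ?thesis by (simp add: E_def)
    qed
    finally show ?thesis .
  qed
  have "E h1 - ?err = avg (\<lambda>f. E (\<lambda>r s g. h1 r s (patch H f g)) - ?err)"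
    by (subst split) (simp_all add: avg_diff h1_def Let_def case_prod_unfold)
  also have "\<dots> \<le> avg (\<lambda>f. E (\<lambda>r s g. h2 r s (patch H f g)))"
    by (intro avg_mono frozen)
  also have "\<dots> = E h2"
    by (rule split[symmetric]) (simp add: h2_def Let_def case_prod_unfold)
  finally show ?thesis unfolding E_def h1_def h2_def .
qed

end

subsection \<open>Attacking a protocol\<close>

lemma finite_bitstrings: "finite (bitstrings n)"
  unfolding bitstrings_def using finite_lists_length_eq[of "UNIV :: bool set" n] by simp

lemma finite_oracles_bitstrings: "finite_oracles (bitstrings n) (bitstrings n)"
proof
  have "replicate n False \<in> bitstrings n" by (simp add: bitstrings_def)
  then show "bitstrings n \<noteq> {}" by blast
qed (rule finite_bitstrings)+

abbreviation short_bits :: "nat \<Rightarrow> bits set" where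
  "short_bits c \<equiv> {m. length m \<le> c}"

lemma finite_short_bits: "finite (short_bits c)"
  using finite_lists_length_le[of "UNIV :: bool set" c] by simp

lemma card_short_bits_le: "card (short_bits c) \<le> 2 ^ (c + 1)"
proof -
  have "card (short_bits c) = (\<Sum>i\<le>c. 2 ^ i)"
    using card_lists_length_le[of "UNIV :: bool set" c] by simp
  also have "\<dots> \<le> 2 ^ (c + 1)"
    by (induction c) auto
  finally show ?thesis .
qed

text \<open>Because \<open>ln 2 \<le> 1\<close>, a number of bits also bounds the entropy in
  nats.\<close>

lemma ln_card_le:
  assumes "finite S" "S \<noteq> {}" "card S \<le> 2 ^ k"
  shows "ln (card S) \<le> real k"
proof -
  have "ln (real (card S)) \<le> ln (2 ^ k)"
  proof (rule ln_mono)
    show "real (card S) \<le> 2 ^ k"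
      using assms(3) by (metis of_nat_le_iff of_nat_numeral of_nat_power)
    show "0 < real (card S)"
      using assms(1,2) by (simp add: card_gt_0_iff)
  qed
  also have "\<dots> = k * ln 2" by (simp add: ln_realpow)
  also have "\<dots> \<le> real k * 1" using ln_le_minus_one[of 2] by (intro mult_left_mono) auto
  finally show ?thesis by simp
qed

section \<open>The attack as a decision tree\<close>

text \<open>The table \<open>g\<close> starts with default values and is overwritten by the answers;
  the continuation receives the whole table, so a later batch of queries can be chosen from earlier
  answers.\<close>

primrec ask :: "bits list \<Rightarrow> (bits \<Rightarrow> bits) \<Rightarrow> ((bits \<Rightarrow> bits) \<Rightarrow> oracle_alg) \<Rightarrow> oracle_alg" where
  "ask [] g k = k g"
| "ask (x # xs) g k = Query x (\<lambda>y. ask xs (g(x := y)) k)"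

lemma fun_upd_patch: "patch S f (g(x := f x)) = patch (insert x S) f g"
  by (auto simp: override_on_def fun_eq_iff)

lemma run_ask: "run f (ask xs g k) = run f (k (patch (set xs) f g))"
proof (induction xs arbitrary: g)
  case Nil
  then show ?case by (simp add: override_on_def)
qed (simp add: fun_upd_patch)

lemma queries_made_ask:
  "queries_made f (ask xs g k) = xs @ queries_made f (k (patch (set xs) f g))"
proof (induction xs arbitrary: g)
  case Nil
  then show ?case by (simp add: override_on_def)
qed (simp add: fun_upd_patch)

definition enumeration :: "'x set \<Rightarrow> 'x list" where
  "enumeration S = (SOME xs. set xs = S \<and> distinct xs)"

lemma enumeration:
  assumes "finite S"
  shows "set (enumeration S) = S" "length (enumeration S) = card S"
proof -
  have "set (enumeration S) = S \<and> distinct (enumeration S)"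
    unfolding enumeration_def by (rule someI_ex) (rule finite_distinct_list[OF assms])
  then show "set (enumeration S) = S" "length (enumeration S) = card S"
    using distinct_card by fastforce+
qed

section \<open>From protocol executions to the abstract setting\<close>

lemma expectation_execution:
  fixes h :: "bool \<times> bool \<times> transcript \<Rightarrow> real"
  assumes "\<And>z. 0 \<le> h z" "\<And>z. h z \<le> 1"
  shows "measure_pmf.expectation (execution P f) h =
    measure_pmf.expectation (coins_A P) (\<lambda>r. measure_pmf.expectation (coins_B P) (\<lambda>s.
      let u = map f (queries_A P r); v = map f (queries_B P s); m1 = message_A P r u; m2 = message_B P s v m1
      in h (output_A P r u [m1, m2], output_B P s v [m1, m2], [m1, m2])))"
  unfolding execution_def integral_map_pmf
  by (subst expectation_pair_pmf[where C = 1]) (auto simp: assms Let_def case_prod_unfold)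

lemma expectation_cong_support:
  fixes g h :: "'r \<Rightarrow> real"
  shows "(\<And>r. r \<in> set_pmf p \<Longrightarrow> g r = h r) \<Longrightarrow> measure_pmf.expectation p g = measure_pmf.expectation p h"
  by (intro integral_cong_AE AE_pmfI) auto

lemma transcript_length_le:
  assumes "communication_complexity F P = enat c" "f \<in> F" "r \<in> set_pmf (coins_A P)" "s \<in> set_pmf (coins_B P)"
  defines "m1 \<equiv> message_A P r (map f (queries_A P r))"
  defines "m2 \<equiv> message_B P s (map f (queries_B P s)) m1"
  shows "length m1 \<le> c" "length m2 \<le> c"
proof -
  let ?a = "output_A P r (map f (queries_A P r)) [m1, m2]"
  let ?b = "output_B P s (map f (queries_B P s)) [m1, m2]"
  have "(?a, ?b, [m1, m2]) \<in> set_pmf (execution P f)"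
    unfolding execution_def m2_def m1_def using assms(3,4)
    by (auto simp: Let_def intro!: image_eqI[of _ _ "(r, s)"])
  then have "enat (sum_list (map length [m1, m2])) \<le> (SUP (a, b, t)\<in>set_pmf (execution P f). enat (sum_list (map length t)))"
    by (intro SUP_upper2[of "(?a, ?b, [m1, m2])"]) auto
  also have "\<dots> \<le> communication_complexity F P"
    unfolding communication_complexity_def by (rule SUP_upper[OF assms(2)])
  finally show "length m1 \<le> c" "length m2 \<le> c"
    by (simp_all add: assms(1))
qed

text \<open>The transcript length is only bounded on reachable executions, but the analysis also runs
  Bob on first messages that do not match his oracle answers. Truncating both messages restores
  the bound everywhere and does not affect real executions.\<close>

lemma attack_advantage:
  fixes P :: "('a, 'b) protocol" and \<alpha> \<gamma> \<delta> \<tau> :: real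
  assumes cc: "communication_complexity (all_functions n) P = enat c"
    and qp: "query_protocol n l P" and ka: "key_agreement n (all_functions n) q \<alpha> \<gamma> P"
    and \<delta>: "\<delta> > 0" "2 * (l / \<delta>) \<le> q" and \<tau>: "\<tau> > 0"
  shows "1 - \<alpha> - \<gamma> \<le> 6 * (\<delta> * real (c + 2) / (2 * \<tau>) + 2 * \<tau>)"
proof -
  interpret bo: finite_oracles "bitstrings n" "bitstrings n" by (rule finite_oracles_bitstrings)
  have or_eq: "bo.oracles = all_functions n"
    by (simp add: bo.oracles_def all_functions_def)
  define pA where "pA = coins_A P"
  define pB where "pB = coins_B P"
  define X where "X r = set (queries_A P r)" for r
  define Y where "Y s = set (queries_B P s)" for s
  define A where "A r f = take c (message_A P r (map f (queries_A P r)))" for r f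
  define B where "B s m f = (take c (message_B P s (map f (queries_B P s)) m),
      output_B P s (map f (queries_B P s)) [m, message_B P s (map f (queries_B P s)) m])" for s m f
  define out where "out r m m2 f = output_A P r (map f (queries_A P r)) [m, m2]" for r m m2 f
  define H where "H = bo.heavy pB (\<lambda>_. 1) Y \<delta>"
  define Q where "Q = bo.heavy_given pA A X \<delta> H"
  define guess where "guess = bo.best_guess pA A out X \<delta> H"
  \<comment> \<open>Default answers for points that are not queried; by \<open>run_eve\<close> they
    have no influence on the guess.\<close>
  obtain f0 where f0: "f0 \<in> bo.oracles" using bo.oracles_nonempty by auto
  define alg where "alg m m2 = ask (enumeration H) f0 (\<lambda>g. ask (enumeration (Q g m)) g
    (\<lambda>h. Output (guess m m2 g h)))" for m m2
  define eve where "eve t = return_pmf (alg (t ! 0) (t ! 1))" for t :: transcript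
  have sub: "H \<subseteq> bitstrings n" "Q g m \<subseteq> bitstrings n" for g m
    by (auto simp: H_def Q_def bo.heavy_def bo.heavy_given_def)
  have fin: "finite H" "finite (Q g m)" for g m
    by (rule finite_subset[OF sub(1) finite_bitstrings], rule finite_subset[OF sub(2) finite_bitstrings])
  have card_le: "card S' \<le> l" if "S' \<subseteq> set xs" "length xs \<le> l" for S' and xs :: "bits list"
    using card_mono[OF _ that(1)] card_length[of xs] that(2) by simp
  have "real (card H) \<le> l / \<delta>"
    unfolding H_def
    by (rule bo.card_heavy_le) (use \<delta> qp in \<open>auto simp: Y_def pB_def query_protocol_def intro!: card_le\<close>)
  moreover have "real (card (Q g m)) \<le> l / \<delta>" for g m
    unfolding Q_def bo.heavy_given_def
    by (rule bo.card_heavy_le)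
      (use \<delta> qp in \<open>auto simp: X_def pA_def query_protocol_def intro!: card_le bo.avg_nonneg bo.avg_le_const\<close>)
  ultimately have count: "card H + card (Q g m) \<le> q" for g m
    using \<delta>(2) by (smt (verit) of_nat_add of_nat_le_iff)
  have "query_adversary n (all_functions n) q eve"
    unfolding query_adversary_def
    using count sub fin by (auto simp: eve_def alg_def queries_made_ask enumeration)
  then have sec: "pmf (guess_game (all_functions n) P eve) True \<le> \<gamma>"
    using ka unfolding key_agreement_def secrecy_def by blast
  have run_eve: "run f (alg m m2) = guess m m2 f f" if f: "f \<in> bo.oracles" for f m m2
  proof -
    let ?g = "patch H f f0"
    have "run f (alg m m2) = guess m m2 ?g (patch (Q f m) f ?g)"
      by (simp add: alg_def run_ask enumeration fin) (simp add: Q_def)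
    also have "\<dots> = guess m m2 f f"
      unfolding guess_def by (rule bo.best_guess_patch) (use f f0 in \<open>auto simp: Q_def\<close>)
    finally show ?thesis .
  qed
  define E where "E h = measure_pmf.expectation pA (\<lambda>r. measure_pmf.expectation pB (\<lambda>s. bo.avg (h r s)))"
    for h :: "'a \<Rightarrow> 'b \<Rightarrow> (bits \<Rightarrow> bits) \<Rightarrow> real"
  \<comment> \<open>The parameter \<open>k\<close> is what Alice's output is compared with: Bob's
    output for accuracy, the eavesdropper's guess for secrecy.\<close>
  define real_h where "real_h k r s f = (let u = map f (queries_A P r); v = map f (queries_B P s);
      m1 = message_A P r u; m2 = message_B P s v m1
      in of_bool (output_A P r u [m1, m2] = k f m1 m2 (output_B P s v [m1, m2])) :: real)" for k r s f
  define trunc_h where "trunc_h k r s f = (let m = A r f; (m2, b) = B s m f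
      in of_bool (out r m m2 f = k f m m2 b) :: real)" for k r s f
  have real_trunc: "bo.avg (\<lambda>f. measure_pmf.expectation pA (\<lambda>r. measure_pmf.expectation pB (\<lambda>s. real_h k r s f)))
      = E (trunc_h k)" for k
  proof -
    have b: "\<bar>real_h k r s f\<bar> \<le> 1" for r s f by (simp add: real_h_def Let_def)
    have "bo.avg (\<lambda>f. measure_pmf.expectation pA (\<lambda>r. measure_pmf.expectation pB (\<lambda>s. real_h k r s f)))
        = E (real_h k)"
      unfolding E_def using b by (simp add: bo.expectation_avg[where C = 1] abs_expectation_le)
    also have "\<dots> = E (trunc_h k)"
      unfolding E_def
    proof (intro expectation_cong_support bo.avg_cong)
      fix r s f assume rs: "r \<in> set_pmf pA" "s \<in> set_pmf pB" and f: "f \<in> bo.oracles"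
      show "real_h k r s f = trunc_h k r s f"
        using transcript_length_le[OF cc, of f r s] rs f
        by (simp add: or_eq pA_def pB_def real_h_def trunc_h_def A_def B_def out_def Let_def)
    qed
    finally show ?thesis .
  qed
  have avg_eq: "measure_pmf.expectation (pmf_of_set (all_functions n)) h = bo.avg h" for h :: "_ \<Rightarrow> real"
    unfolding bo.avg_def or_eq
    by (rule integral_pmf_of_set) (use bo.finite_oracles bo.oracles_nonempty in \<open>simp_all add: or_eq\<close>)
  have "1 - \<alpha> \<le> bo.avg (\<lambda>f. measure_pmf.prob (execution P f) {(a, b, t). a = b})"
  proof -
    have "bo.avg (\<lambda>_. 1 - \<alpha>) \<le> bo.avg (\<lambda>f. measure_pmf.prob (execution P f) {(a, b, t). a = b})"
      by (intro bo.avg_mono) (use ka in \<open>auto simp: key_agreement_def accuracy_def or_eq\<close>)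
    then show ?thesis by simp
  qed
  also have "\<dots> = bo.avg (\<lambda>f. measure_pmf.expectation pA (\<lambda>r. measure_pmf.expectation pB (\<lambda>s. real_h (\<lambda>f m m2 b. b) r s f)))"
  proof (rule bo.avg_cong)
    fix f
    have "measure_pmf.prob (execution P f) {(a, b, t). a = b}
        = measure_pmf.expectation (execution P f) (\<lambda>(a, b, t). of_bool (a = b))"
    proof -
      have "(\<lambda>(a, b, t). of_bool (a = b) :: real) = indicator {(a :: bool, b, t :: transcript). a = b}"
        by (auto simp: indicator_def)
      then show ?thesis by simp
    qed
    also have "\<dots> = measure_pmf.expectation pA (\<lambda>r. measure_pmf.expectation pB (\<lambda>s. real_h (\<lambda>f m m2 b. b) r s f))"
      by (subst expectation_execution) (auto simp: pA_def pB_def real_h_def Let_def)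
    finally show "measure_pmf.prob (execution P f) {(a, b, t). a = b} = \<dots>" .
  qed
  also have "\<dots> = E (trunc_h (\<lambda>f m m2 b. b))" by (rule real_trunc)
  finally have acc: "1 - \<alpha> \<le> E (trunc_h (\<lambda>f m m2 b. b))" .
  have "pmf (guess_game (all_functions n) P eve) True =
      bo.avg (\<lambda>f. measure_pmf.expectation (execution P f) (\<lambda>(a, b, t). of_bool (a = run f (alg (t ! 0) (t ! 1)))))"
    unfolding guess_game_def pmf_bind avg_eq
    by (intro bo.avg_cong Bochner_Integration.integral_cong)
      (auto simp: eve_def pmf_return indicator_def)
  also have "\<dots> = bo.avg (\<lambda>f. measure_pmf.expectation pA (\<lambda>r. measure_pmf.expectation pB (\<lambda>s. real_h (\<lambda>f m m2 b. guess m m2 f f) r s f)))"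
  proof (rule bo.avg_cong)
    fix f assume "f \<in> bo.oracles"
    then show "measure_pmf.expectation (execution P f) (\<lambda>(a, b, t). of_bool (a = run f (alg (t ! 0) (t ! 1)))) =
       measure_pmf.expectation pA (\<lambda>r. measure_pmf.expectation pB (\<lambda>s. real_h (\<lambda>f m m2 b. guess m m2 f f) r s f))"
      by (subst expectation_execution) (auto simp: pA_def pB_def real_h_def Let_def run_eve)
  qed
  also have "\<dots> = E (trunc_h (\<lambda>f m m2 b. guess m m2 f f))" by (rule real_trunc)
  finally have eve_success: "E (trunc_h (\<lambda>f m m2 b. guess m m2 f f)) \<le> \<gamma>" using sec by simp
  \<comment> \<open>Bob's message is treated jointly with his output bit: at most
    \<open>2 ^ (c + 1)\<close> strings times two bits give the exponent \<open>c + 2\<close>, which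
    also covers Alice's message.\<close>
  let ?W = "short_bits c \<times> (UNIV :: bool set)"
  have ne: "short_bits c \<noteq> {}" using list.size(3)[where 'a = bool] by (metis (mono_tags) empty_iff le0 mem_Collect_eq)
  have "ln (card (short_bits c)) \<le> real (c + 1)"
    by (rule ln_card_le[OF finite_short_bits ne card_short_bits_le])
  then have L1: "ln (card (short_bits c)) \<le> real (c + 2)" by simp
  have L2: "ln (card ?W) \<le> real (c + 2)"
    by (rule ln_card_le) (use finite_short_bits ne card_short_bits_le[of c] in \<open>auto simp: card_cartesian_product\<close>)
  have mem: "A r f \<in> short_bits c" "B s m f \<in> ?W" for r s m f
    by (simp_all add: A_def B_def)
  have base: "bo.depends (set xs) (\<lambda>f. map f xs)" for xs
    by (simp add: bo.depends_def)
  have dep: "bo.depends (X r) (A r)" "bo.depends (Y s) (B s m)" "bo.depends (X r) (out r m m2)" for r s m m2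
    unfolding A_def B_def out_def X_def Y_def
    by (rule bo.depends_comp[OF base, where k = "\<lambda>u. take c (message_A P r u)"],
      rule bo.depends_comp[OF base, where k = "\<lambda>v. (take c (message_B P s v m),
        output_B P s v [m, message_B P s v m])"],
      rule bo.depends_comp[OF base, where k = "\<lambda>u. output_A P r u [m, m2]"])
  have "E (trunc_h (\<lambda>f m m2 b. b)) - 6 * (\<delta> * real (c + 2) / (2 * \<tau>) + 2 * \<tau>)
      \<le> E (trunc_h (\<lambda>f m m2 b. guess m m2 f f))"
    unfolding E_def trunc_h_def guess_def H_def
    by (rule bo.heavy_query_attack[OF finite_short_bits _ _ _ _ _ _ L1 L2])
      (use mem dep \<tau> \<delta> finite_short_bits in auto)
  then show ?thesis using acc eve_success by linarith
qed

theorem theorem6p1: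
  fixes n l q :: nat and \<alpha> \<gamma> :: real and P :: "('a, 'b) protocol"
  assumes "n \<ge> 1" and "l \<ge> 1" and "q \<ge> 1"
    and "0 \<le> \<alpha>" and "\<alpha> \<le> 1" and "0 \<le> \<gamma>" and "\<gamma> \<le> 1" and "\<gamma> \<le> 1 - \<alpha>"
    and "query_protocol n l P"
    and "key_agreement n (all_functions n) q \<alpha> \<gamma> P"
  shows "ereal_of_enat (communication_complexity (all_functions n) P)
           \<ge> ereal ((1 - \<alpha> - \<gamma>)\<^sup>2 * real q / (50\<^sup>2 * real l) - 6)"
proof (cases "communication_complexity (all_functions n) P")
  case (enat c)
  \<comment> \<open>With this threshold the two rounds of at most \<open>l / \<delta>\<close>
    queries add up to exactly the budget \<open>q\<close>.\<close>
  define \<delta> where "\<delta> = 2 * real l / real q"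
  \<comment> \<open>The choice \<open>\<tau> = t / 2\<close> balances the two error terms: both
    become \<open>t\<close>, and the advantage is at most \<open>12 * t\<close>.\<close>
  define t where "t = sqrt (\<delta> * real (c + 2))"
  have \<delta>: "\<delta> > 0" using assms by (simp add: \<delta>_def)
  then have t: "t > 0" "t * t = \<delta> * real (c + 2)" by (simp_all add: t_def)
  have "1 - \<alpha> - \<gamma> \<le> 6 * (\<delta> * real (c + 2) / (2 * (t / 2)) + 2 * (t / 2))"
    by (rule attack_advantage[OF enat assms(9,10)]) (use \<delta> t assms in \<open>auto simp: \<delta>_def\<close>)
  also have "\<dots> = 12 * t" unfolding t(2)[symmetric] using t(1) by simp
  finally have "(1 - \<alpha> - \<gamma>)\<^sup>2 \<le> (12 * t)\<^sup>2"
    using assms by (intro power_mono) auto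
  also have "\<dots> = 144 * (\<delta> * real (c + 2))" unfolding t(2)[symmetric] by (simp add: power2_eq_square)
  also have "\<dots> = 288 * real (c + 2) * real l / real q" by (simp add: \<delta>_def)
  finally have "(1 - \<alpha> - \<gamma>)\<^sup>2 * real q \<le> 288 * real (c + 2) * real l"
    using assms by (simp add: pos_le_divide_eq)
  then have "(1 - \<alpha> - \<gamma>)\<^sup>2 * real q / (50\<^sup>2 * real l) \<le> 288 * real (c + 2) / 50\<^sup>2"
    using assms by (simp add: field_simps)
  \<comment> \<open>Here \<open>288 \<le> 50\<^sup>2\<close> leaves ample room.\<close>
  also have "\<dots> \<le> real c + 6" by simp
  finally show ?thesis using enat by simp
qed simp

end
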